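(* Let $n\geq 4$ be even. Let $N\in\{n,n-2\}$, and let $x=\alpha_0$ if $N=n$ (respectively $x=\alpha_0\alpha_2\alpha_0^{-1}$ if $N=n-2$). Write $N=2^l k$, where $l\in\mathbb{N}$ and $k$ is odd. Then for $j=0,1,\dots,l$ and $q$ a divisor of $k$, we have: (a) $B_n(\mathbb{S}^2)$ contains $2^j$ copies of $\mathrm{Dic}_{2^{l+2-j}k/q}$ of the form $\langle x^{2^j q}, x^{iq}T_n\rangle$, where $i=0,1,\dots,2^j-1$; (b) if $0\leq i,i'\leq 2^j-1$, the subgroups $\langle x^{2^j q}, x^{iq}T_n\rangle$ and $\langle x^{2^j q}, x^{i'q}T_n\rangle$ are conjugate in $B_n(\mathbb{S}^2)$ if and only if $i-i'$ is even.
   Context: $B_n(\mathbb{S}^2)$ is the $n$-string braid group of the $2$-sphere, presented by generators $\sigma_1,\dots,\sigma_{n-1}$ and relations $\sigma_i\sigma_j=\sigma_j\sigma_i$ if $|i-j|\geq 2$; $\sigma_i\sigma_{i+1}\sigma_i=\sigma_{i+1}\sigma_i\sigma_{i+1}$ for $1\leq i\leq n-2$; and $\sigma_1\cdots\sigma_{n-2}\sigma_{n-1}^2\sigma_{n-2}\cdots\sigma_1=1$. In $B_n(\mathbb{S}^2)$ set $\alpha_0=\sigma_1\cdots\sigma_{n-2}\sigma_{n-1}$ (of order $2n$), $\alpha_2=\sigma_1\cdots\sigma_{n-3}\sigma_{n-2}^2$ (of order $2(n-2)$), and let $T_n=(\sigma_1\cdots\sigma_{n-1})(\sigma_1\cdots\sigma_{n-2})\cdots(\sigma_1\sigma_2)\sigma_1$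 be the Garside element (half twist). $\mathrm{Dic}_{4m}$ (subscript equal to the order) denotes the dicyclic group of order $4m$, $\langle u,v \mid u^m=v^2,\ vuv^{-1}=u^{-1}\rangle$; for $m=1$ this is $\mathbb{Z}_4$. *)

theory Defs
  imports "HOL-Algebra.Algebra"
begin

text \<open>
  A letter \<open>(a, e)\<close> of a group word stands for the generator \<open>a\<close> if \<open>e\<close> is \<open>False\<close>
  and for its formal inverse if \<open>e\<close> is \<open>True\<close>.
\<close>

type_synonym 'a group_word = "('a \<times> bool) list"

definition words :: "'a set \<Rightarrow> 'a group_word set"
  where "words S = lists (S \<times> UNIV)"

text \<open>
  The smallest congruence on the words over \<open>S\<close> that contains the free cancellations and the
  relations \<open>R\<close>; a pair \<open>(u, v)\<close> in \<open>R\<close> is the relation \<open>u = v\<close>.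
\<close>

inductive pres_eq :: "'a set \<Rightarrow> ('a group_word \<times> 'a group_word) set
    \<Rightarrow> 'a group_word \<Rightarrow> 'a group_word \<Rightarrow> bool"
  for S R where
    refl: "w \<in> words S \<Longrightarrow> pres_eq S R w w"
  | sym: "pres_eq S R u v \<Longrightarrow> pres_eq S R v u"
  | trans: "pres_eq S R u v \<Longrightarrow> pres_eq S R v w \<Longrightarrow> pres_eq S R u w"
  | append: "pres_eq S R u u' \<Longrightarrow> pres_eq S R v v' \<Longrightarrow> pres_eq S R (u @ v) (u' @ v')"
  | cancel: "a \<in> S \<Longrightarrow> pres_eq S R [(a, e), (a, \<not> e)] []"
  | rel: "(u, v) \<in> R \<Longrightarrow> u \<in> words S \<Longrightarrow> v \<in> words S \<Longrightarrow> pres_eq S R u v"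

definition word_class :: "'a set \<Rightarrow> ('a group_word \<times> 'a group_word) set
    \<Rightarrow> 'a group_word \<Rightarrow> 'a group_word set"
  where "word_class S R w = {v. pres_eq S R w v}"

definition presented_group :: "'a set \<Rightarrow> ('a group_word \<times> 'a group_word) set
    \<Rightarrow> 'a group_word set monoid"
  where "presented_group S R =
    \<lparr>carrier = word_class S R ` words S,
     monoid.mult = (\<lambda>A B. {w. \<exists>u\<in>A. \<exists>v\<in>B. pres_eq S R (u @ v) w}),
     monoid.one = word_class S R []\<rparr>"

lemma pres_eq_words: "pres_eq S R u v \<Longrightarrow> u \<in> words S \<and> v \<in> words S"
  by (induction rule: pres_eq.induct) (auto simp: words_def)

lemma word_class_eq_iff:
  assumes "u \<in> words S"
  shows "word_class S R u = word_class S R v \<longleftrightarrow> pres_eq S R u v"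
  using assms unfolding word_class_def
  by (auto intro: pres_eq.refl pres_eq.sym pres_eq.trans)

lemma word_class_mult:
  assumes "u \<in> words S" and "v \<in> words S"
  shows "word_class S R u \<otimes>\<^bsub>presented_group S R\<^esub> word_class S R v = word_class S R (u @ v)"
  using assms unfolding word_class_def presented_group_def
  by (auto intro: pres_eq.refl pres_eq.append pres_eq.trans)

lemma pres_eq_left_inverse:
  "w \<in> words S \<Longrightarrow> pres_eq S R (rev (map (apsnd Not) w) @ w) []"
proof (induction w)
  case Nil
  then show ?case by (auto intro: pres_eq.refl)
next
  case (Cons p w)
  obtain a e where p: "p = (a, e)" by (cases p)
  define w' where "w' = rev (map (apsnd Not) w)"
  have a: "a \<in> S" and w: "w \<in> words S" and w': "w' \<in> words S"
    using Cons.prems by (force simp: words_def p w'_def)+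
  have "pres_eq S R ([(a, \<not> e), (a, e)] @ w) ([] @ w)"
    using pres_eq.cancel[OF a, of R "\<not> e"] by (intro pres_eq.append pres_eq.refl w) simp
  then have "pres_eq S R (w' @ ([(a, \<not> e), (a, e)] @ w)) (w' @ w)"
    by (intro pres_eq.append pres_eq.refl w') simp
  then show ?case
    using Cons.IH[OF w] by (auto simp: p w'_def intro: pres_eq.trans)
qed

lemma group_presented_group: "group (presented_group S R)"
proof (rule groupI)
  let ?G = "presented_group S R"
  have carr: "carrier ?G = word_class S R ` words S" and one: "\<one>\<^bsub>?G\<^esub> = word_class S R []"
    by (simp_all add: presented_group_def)
  have app: "u @ v \<in> words S" if "u \<in> words S" "v \<in> words S" for u v :: "'a group_word"
    using that by (auto simp: words_def)
  have nil: "[] \<in> words S" by (simp add: words_def)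
  show "x \<otimes>\<^bsub>?G\<^esub> y \<in> carrier ?G" if "x \<in> carrier ?G" "y \<in> carrier ?G" for x y
    using that by (auto simp: carr word_class_mult app)
  show "\<one>\<^bsub>?G\<^esub> \<in> carrier ?G"
    by (simp add: carr one nil)
  show "x \<otimes>\<^bsub>?G\<^esub> y \<otimes>\<^bsub>?G\<^esub> z = x \<otimes>\<^bsub>?G\<^esub> (y \<otimes>\<^bsub>?G\<^esub> z)"
    if "x \<in> carrier ?G" "y \<in> carrier ?G" "z \<in> carrier ?G" for x y z
    using that by (auto simp: carr word_class_mult app)
  show "\<one>\<^bsub>?G\<^esub> \<otimes>\<^bsub>?G\<^esub> x = x" if "x \<in> carrier ?G" for x
    using that by (auto simp: carr one word_class_mult nil)
  show "\<exists>y\<in>carrier ?G. y \<otimes>\<^bsub>?G\<^esub> x = \<one>\<^bsub>?G\<^esub>" if x: "x \<in> carrier ?G" for x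
  proof -
    obtain w where w: "w \<in> words S" "x = word_class S R w" using x by (auto simp: carr)
    define w' where "w' = rev (map (apsnd Not) w)"
    have w': "w' \<in> words S" using w(1) by (force simp: words_def w'_def)
    have "word_class S R (w' @ w) = word_class S R []"
      using pres_eq_left_inverse[OF w(1), of R] word_class_eq_iff[OF app[OF w' w(1)]]
      by (simp add: w'_def)
    then show ?thesis
      using w w' by (auto simp: carr one word_class_mult)
  qed
qed

abbreviation pos_letter :: "'a \<Rightarrow> 'a \<times> bool"
  where "pos_letter a \<equiv> (a, False)"

abbreviation neg_letter :: "'a \<Rightarrow> 'a \<times> bool"
  where "neg_letter a \<equiv> (a, True)"

abbreviation pos_word :: "'a list \<Rightarrow> 'a group_word"
  where "pos_word xs \<equiv> map pos_letter xs"

text \<open>The generator \<open>\<sigma>\<^sub>i\<close> is the letter \<open>i\<close>, for \<open>1 \<le> i \<le> n - 1\<close>.\<close>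

definition sphere_braid_rels :: "nat \<Rightarrow> (nat group_word \<times> nat group_word) set"
  where "sphere_braid_rels n =
    {(pos_word [i, j], pos_word [j, i]) | i j.
       i \<in> {1..<n} \<and> j \<in> {1..<n} \<and> \<bar>int i - int j\<bar> \<ge> 2}
    \<union> {(pos_word [i, i + 1, i], pos_word [i + 1, i, i + 1]) | i. 1 \<le> i \<and> i + 2 \<le> n}
    \<union> {(pos_word ([1..<n] @ rev [1..<n]), [])}"

definition sphere_braid_group :: "nat \<Rightarrow> nat group_word set monoid"
  where "sphere_braid_group n = presented_group {1..<n} (sphere_braid_rels n)"

text \<open>The element \<open>\<sigma>\<^bsub>i\<^sub>1\<^esub> \<dots> \<sigma>\<^bsub>i\<^sub>r\<^esub>\<close> given by a list \<open>[i\<^sub>1, \<dots>, i\<^sub>r]\<close> of indices.\<close>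

definition sphere_braid :: "nat \<Rightarrow> nat list \<Rightarrow> nat group_word set"
  where "sphere_braid n is = word_class {1..<n} (sphere_braid_rels n) (pos_word is)"

definition alpha0 :: "nat \<Rightarrow> nat group_word set"
  where "alpha0 n = sphere_braid n [1..<n]"

text \<open>\<open>\<sigma>\<^sub>1 \<dots> \<sigma>\<^bsub>n-3\<^esub> \<sigma>\<^bsub>n-2\<^esub>\<^sup>2\<close>; meaningful for \<open>n \<ge> 3\<close>.\<close>

definition alpha2 :: "nat \<Rightarrow> nat group_word set"
  where "alpha2 n = sphere_braid n ([1..<n - 2] @ [n - 2, n - 2])"

text \<open>The factors \<open>\<sigma>\<^sub>1 \<dots> \<sigma>\<^bsub>m-1\<^esub>\<close> for \<open>m = n, n - 1, \<dots>, 2\<close>, in this order.\<close>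

definition half_twist :: "nat \<Rightarrow> nat group_word set"
  where "half_twist n = sphere_braid n (concat (map (\<lambda>m. [1..<m]) (rev [2..<n + 1])))"

definition twist_subgroup ::
    "nat \<Rightarrow> nat group_word set \<Rightarrow> nat \<Rightarrow> nat \<Rightarrow> nat \<Rightarrow> nat group_word set set"
  where "twist_subgroup n x j q i = generate (sphere_braid_group n)
    {x [^]\<^bsub>sphere_braid_group n\<^esub> (2 ^ j * q),
     x [^]\<^bsub>sphere_braid_group n\<^esub> (i * q) \<otimes>\<^bsub>sphere_braid_group n\<^esub> half_twist n}"

datatype dic_gen = Dic_u | Dic_v

definition dic_rels :: "nat \<Rightarrow> (dic_gen group_word \<times> dic_gen group_word) set"
  where "dic_rels m =
    {(pos_word (replicate m Dic_u), pos_word [Dic_v, Dic_v]),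
     ([pos_letter Dic_v, pos_letter Dic_u, neg_letter Dic_v], [neg_letter Dic_u])}"

text \<open>The index is the order \<open>4m\<close> of the group, so it has to be a positive multiple of 4.\<close>

definition Dic :: "nat \<Rightarrow> dic_gen group_word set monoid"
  where "Dic d = presented_group UNIV (dic_rels (d div 4))"

definition conjugate_subgroups :: "('a, 'b) monoid_scheme \<Rightarrow> 'a set \<Rightarrow> 'a set \<Rightarrow> bool"
  where "conjugate_subgroups G H K \<longleftrightarrow>
    (\<exists>g\<in>carrier G. K = g <#\<^bsub>G\<^esub> H #>\<^bsub>G\<^esub> inv\<^bsub>G\<^esub> g)"

end

(*
  In both cases x^N = T^2, T x T^-1 = x^-1 and x has order 2N, so that <x, T> is dicyclic of
  order 4N; the subgroups in question are its dicyclic subgroups, and they are told apart inside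
  <x, T> by arithmetic of exponents. Conjugation by a power x^s replaces x^c T by x^(c + 2s) T;
  as n is even, x has odd length and the length parity homomorphism to Z/2 excludes every other
  conjugation.

  The relations come from Garside's identities in the positive braid monoid. The order of x
  reduces to T^2 not being trivial: the number of crossings among any three strands is an
  invariant modulo 4 (B_n(S^2) acts monomially on the triples of strands, with coefficients in
  the abelianization Z/4 of B_3(S^2)), and for T^2 it is 6.
*)
theory Submission
  imports Defs
begin

text \<open>The lower bound on the order of x is the obstacle. Permutations show that x^r is
  nontrivial for 0 < r < N, but they do not see x^N = T^2, a pure braid. For even n the
  abelianization Z/2(n-1) does not see it either, since its length n(n-1) is a multiple of 2(n-1).
  Crossings of a single pair of strands fail as well: the sphere relation makes strand 1 cross every
  other strand twice, so they are defined only modulo 2, and T^2 crosses each pair twice. With three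
  strands the relation contributes 0 or 4, and T^2 is detected.

  The conjugation by \<open>alpha0 n\<close> in the case N = n - 2 is there for the sake of T.
  Conjugation by T reverses positions, so T can invert a braid only if the positions fixed by its
  permutation form a symmetric set. The permutation of \<open>alpha2 n\<close> fixes n - 1 and n;
  that of the conjugate fixes 1 and n.\<close>

section \<open>Garside identities for positive braids\<close>

text \<open>The positive braid monoid on infinitely many generators: with no bound on the letters,
  inductions on the number of strands stay inside one relation. Both kinds of relation preserve the
  set of letters, so a derivation that starts with generators of the sphere group never leaves
  them.\<close>

inductive braid_eq :: "nat list \<Rightarrow> nat list \<Rightarrow> bool" (infix \<open>\<doteq>\<close> 50) where
  refl: "u \<doteq> u"
| sym: "u \<doteq> v \<Longrightarrow> v \<doteq> u"
| trans: "u \<doteq> v \<Longrightarrow> v \<doteq> w \<Longrightarrow> u \<doteq> w"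
| append: "u \<doteq> u' \<Longrightarrow> v \<doteq> v' \<Longrightarrow> u @ v \<doteq> u' @ v'"
| far: "i + 2 \<le> j \<Longrightarrow> [i, j] \<doteq> [j, i]"
| near: "[i, i + 1, i] \<doteq> [i + 1, i, i + 1]"

declare braid_eq.trans [trans]

lemma braid_eq_context: "u \<doteq> v \<Longrightarrow> p @ u @ r \<doteq> p @ v @ r"
  by (intro braid_eq.append braid_eq.refl)

lemma braid_eq_set: "u \<doteq> v \<Longrightarrow> set u = set v"
  by (induction rule: braid_eq.induct) auto

lemma braid_eq_rev: "u \<doteq> v \<Longrightarrow> rev u \<doteq> rev v"
proof (induction rule: braid_eq.induct)
  case (append u u' v v')
  then show ?case by (auto intro: braid_eq.append)
next
  case (far i j)
  then show ?case using braid_eq.sym[OF braid_eq.far] by simp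
next
  case (near i)
  then show ?case using braid_eq.near[of i] by simp
qed (blast intro: braid_eq.intros)+

lemma far_commute:
  assumes "\<And>j. j \<in> set u \<Longrightarrow> j + 2 \<le> i \<or> i + 2 \<le> j"
  shows "u @ [i] \<doteq> i # u"
  using assms
proof (induction u)
  case Nil
  then show ?case by (simp add: braid_eq.refl)
next
  case (Cons j u)
  have "[j] @ (u @ [i]) @ [] \<doteq> [j] @ (i # u) @ []"
    by (intro braid_eq_context Cons.IH Cons.prems) simp
  also have "[j] @ (i # u) @ [] = [] @ [j, i] @ u" by simp
  also have "\<dots> \<doteq> [] @ [i, j] @ u"
    using Cons.prems[of j] braid_eq.far[of j i] braid_eq.sym[OF braid_eq.far[of i j]]
    by (intro braid_eq_context) auto
  finally show ?case by simp
qed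

text \<open>The letter i passes the part of the sweep from i + 2 on, one braid relation turns it
  into i + 1, and that letter passes the part below i. This index shift drives most identities
  below.\<close>

lemma sweep_shift:
  assumes "b \<le> i" "i + 1 < m"
  shows "[b..<m] @ [i] \<doteq> (i + 1) # [b..<m]"
proof -
  have split: "[b..<m] = [b..<i] @ [i, i + 1] @ [i + 2..<m]"
    using assms upt_add_eq_append[of b i "m - i"] by (simp add: upt_conv_Cons)
  have "[b..<m] @ [i] = ([b..<i] @ [i, i + 1]) @ ([i + 2..<m] @ [i]) @ []"
    by (simp add: split)
  also have "\<dots> \<doteq> ([b..<i] @ [i, i + 1]) @ (i # [i + 2..<m]) @ []"
    by (intro braid_eq_context far_commute) auto
  also have "\<dots> = [b..<i] @ [i, i + 1, i] @ [i + 2..<m]" by simp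
  also have "\<dots> \<doteq> [b..<i] @ [i + 1, i, i + 1] @ [i + 2..<m]"
    by (intro braid_eq_context braid_eq.near)
  also have "\<dots> = [] @ ([b..<i] @ [i + 1]) @ [i, i + 1] @ [i + 2..<m]" by simp
  also have "\<dots> \<doteq> [] @ ((i + 1) # [b..<i]) @ [i, i + 1] @ [i + 2..<m]"
    by (intro braid_eq_context far_commute) auto
  also have "\<dots> = (i + 1) # [b..<m]" by (simp add: split)
  finally show ?thesis .
qed

lemma rev_sweep_shift:
  assumes "b \<le> i" "i + 1 < m"
  shows "rev [b..<m] @ [i + 1] \<doteq> i # rev [b..<m]"
  using braid_eq_rev[OF sweep_shift[OF assms]] by (auto intro: braid_eq.sym)

lemma commute_map:
  assumes "\<And>i. i \<in> set w \<Longrightarrow> u @ [i] \<doteq> f i # u"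
  shows "u @ w \<doteq> map f w @ u"
  using assms
proof (induction w)
  case Nil
  then show ?case by (simp add: braid_eq.refl)
next
  case (Cons i w)
  have "u @ (i # w) = [] @ (u @ [i]) @ w" by simp
  also have "\<dots> \<doteq> [] @ (f i # u) @ w"
    by (intro braid_eq_context Cons.prems) simp
  also have "\<dots> = [f i] @ (u @ w) @ []" by simp
  also have "\<dots> \<doteq> [f i] @ (map f w @ u) @ []"
    by (intro braid_eq_context Cons.IH Cons.prems) simp
  finally show ?case by simp
qed

text \<open>The half twist on m strands, so its letters are below m. The recursion gives the word of
  \<open>half_twist\<close>, see \<open>half_twist_eq\<close>.\<close>

fun garside :: "nat \<Rightarrow> nat list" where
  "garside 0 = []"
| "garside (Suc m) = [1..<Suc m] @ garside m"

lemma set_garside: "set (garside m) \<subseteq> {1..<m}"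
  by (induction m) auto

text \<open>The outermost strand can be split off on the right instead of the left: in the induction
  step the last letter of the leading sweep is at least two above every letter of the inner half
  twist and slides past it.\<close>

lemma garside_rev_sweep: "garside (Suc m) \<doteq> garside m @ rev [1..<Suc m]"
proof (induction m)
  case 0
  then show ?case by (simp add: braid_eq.refl)
next
  case (Suc m)
  show ?case
  proof (cases "m = 0")
    case True
    then show ?thesis by (simp add: braid_eq.refl)
  next
    case False
    have "garside (Suc (Suc m)) = [1..<Suc (Suc m)] @ garside (Suc m) @ []" by simp
    also have "\<dots> \<doteq> [1..<Suc (Suc m)] @ (garside m @ rev [1..<Suc m]) @ []"
      by (intro braid_eq_context Suc.IH)
    also have "\<dots> = [1..<Suc m] @ (Suc m # garside m) @ rev [1..<Suc m]" by simp
    also have "\<dots> \<doteq> [1..<Suc m] @ (garside m @ [Suc m]) @ rev [1..<Suc m]"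
      using set_garside[of m]
      by (intro braid_eq_context braid_eq.sym[OF far_commute]) fastforce
    also have "\<dots> = garside (Suc m) @ rev [1..<Suc (Suc m)]" by simp
    finally show ?thesis .
  qed
qed

lemma garside_flip: "1 \<le> i \<Longrightarrow> i < m \<Longrightarrow> garside m @ [i] \<doteq> (m - i) # garside m"
proof (induction m arbitrary: i)
  case 0
  then show ?case by simp
next
  case (Suc m)
  show ?case
  proof (cases "i < m")
    case True
    have "garside (Suc m) @ [i] = [1..<Suc m] @ (garside m @ [i]) @ []" by simp
    also have "\<dots> \<doteq> [1..<Suc m] @ ((m - i) # garside m) @ []"
      by (intro braid_eq_context Suc.IH True Suc.prems)
    also have "\<dots> = [] @ ([1..<Suc m] @ [m - i]) @ garside m" by simp
    also have "\<dots> \<doteq> [] @ ((m - i + 1) # [1..<Suc m]) @ garside m"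
      using True Suc.prems by (intro braid_eq_context sweep_shift) auto
    also have "\<dots> = (Suc m - i) # garside (Suc m)" using True by (simp add: Suc_diff_le)
    finally show ?thesis .
  next
    case False
    then have i: "i = m" using Suc.prems by simp
    show ?thesis
    proof (cases "m = 1")
      case True
      then show ?thesis using i by (simp add: braid_eq.refl)
    next
      case False
      then have m: "2 \<le> m" using i Suc.prems by simp
      \<comment> \<open>The top letter is out of range for the inner half twist, so the right-hand
        factorisation is used: the reversed sweep lowers the letter to m - 1, which the inner half
        twist reflects to 1.\<close>
      have "garside (Suc m) @ [i] = [] @ garside (Suc m) @ [m]" by (simp add: i)
      also have "\<dots> \<doteq> [] @ (garside m @ rev [1..<Suc m]) @ [m]"
        by (intro braid_eq_context garside_rev_sweep)
      also have "\<dots> = garside m @ (rev [1..<Suc m] @ [m - 1 + 1]) @ []"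
        using m by simp
      also have "\<dots> \<doteq> garside m @ ((m - 1) # rev [1..<Suc m]) @ []"
        using m by (intro braid_eq_context rev_sweep_shift) auto
      also have "\<dots> = [] @ (garside m @ [m - 1]) @ rev [1..<Suc m]" by simp
      also have "\<dots> \<doteq> [] @ ((m - (m - 1)) # garside m) @ rev [1..<Suc m]"
        using m by (intro braid_eq_context Suc.IH) auto
      also have "\<dots> = [1] @ (garside m @ rev [1..<Suc m]) @ []"
        using m by simp
      also have "\<dots> \<doteq> [1] @ garside (Suc m) @ []"
        by (intro braid_eq_context braid_eq.sym[OF garside_rev_sweep])
      finally show ?thesis using i by simp
    qed
  qed
qed

text \<open>The two factorisations of the half twist meet in the loop \<open>?R @ ?A\<close> of the
  last strand around all others. It commutes with the letters below m because the sweep raises an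
  index by one and the reversed sweep lowers it again. On the sphere this loop is trivial, which
  identifies the full twists on n and n - 1 strands.\<close>

lemma garside_square:
  "garside (Suc m) @ garside (Suc m) \<doteq> garside m @ garside m @ rev [1..<Suc m] @ [1..<Suc m]"
proof -
  let ?R = "rev [1..<Suc m]" and ?A = "[1..<Suc m]"
  have "garside (Suc m) @ garside (Suc m) = [] @ garside (Suc m) @ garside (Suc m)" by simp
  also have "\<dots> \<doteq> [] @ (garside m @ ?R) @ garside (Suc m)"
    by (intro braid_eq_context garside_rev_sweep)
  also have "\<dots> = garside m @ ((?R @ ?A) @ garside m) @ []" by simp
  also have "\<dots> \<doteq> garside m @ (map id (garside m) @ (?R @ ?A)) @ []"
  proof (intro braid_eq_context commute_map)
    fix i assume "i \<in> set (garside m)"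
    then have i: "1 \<le> i" "i + 1 < Suc m" using set_garside[of m] by auto
    have "(?R @ ?A) @ [i] = ?R @ (?A @ [i]) @ []" by simp
    also have "\<dots> \<doteq> ?R @ ((i + 1) # ?A) @ []"
      using i by (intro braid_eq_context sweep_shift) auto
    also have "\<dots> = [] @ (?R @ [i + 1]) @ ?A" by simp
    also have "\<dots> \<doteq> [] @ (i # ?R) @ ?A"
      using i by (intro braid_eq_context rev_sweep_shift) auto
    finally show "(?R @ ?A) @ [i] \<doteq> id i # ?R @ ?A" by simp
  qed
  finally show ?thesis by simp
qed

section \<open>Roots of the full twist\<close>

abbreviation word_pow :: "nat list \<Rightarrow> nat \<Rightarrow> nat list" (infixr \<open>\<up>\<close> 80)
  where "w \<up> r \<equiv> concat (replicate r w)"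

lemma word_pow_Suc_right: "w \<up> Suc r = w \<up> r @ w"
  by (induction r) auto

lemma sweep_push:
  assumes "\<And>i. i \<in> set w \<Longrightarrow> 1 \<le> i \<and> i + 1 < m"
  shows "map Suc w @ [1..<m] \<doteq> [1..<m] @ w"
  using commute_map[of w "[1..<m]" Suc] sweep_shift[of 1 _ m] assms
  by (auto intro: braid_eq.sym)

text \<open>Each further sweep lowers the letters of the tail by one as they cross it, and puts its
  own last letter m in front of them.\<close>

lemma sweep_power_drop:
  assumes "r \<le> m"
  shows "[1..<Suc m] \<up> r \<doteq> [1..<m] \<up> r @ rev [Suc m - r..<Suc m]"
  using assms
proof (induction r)
  case 0
  then show ?case by (simp add: braid_eq.refl)
next
  case (Suc r)
  have "[1..<Suc m] \<up> Suc r = [] @ [1..<Suc m] \<up> r @ [1..<Suc m]"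
    by (simp only: word_pow_Suc_right append_Nil)
  also have "\<dots> \<doteq> [] @ ([1..<m] \<up> r @ rev [Suc m - r..<Suc m]) @ [1..<Suc m]"
    using Suc by (intro braid_eq_context) simp
  also have "\<dots> = [1..<m] \<up> r @ (map Suc (rev [m - r..<m]) @ [1..<Suc m]) @ []"
    using Suc.prems by (simp add: rev_map[symmetric] map_Suc_upt Suc_diff_le del: upt_Suc)
  also have "\<dots> \<doteq> [1..<m] \<up> r @ ([1..<Suc m] @ rev [m - r..<m]) @ []"
    using Suc.prems by (intro braid_eq_context sweep_push) auto
  also have "\<dots> = [1..<m] \<up> Suc r @ rev [Suc m - Suc r..<Suc m]"
    using Suc.prems by (simp only: word_pow_Suc_right) simp
  finally show ?case .
qed

text \<open>For r = m the tail in \<open>sweep_power_drop\<close> is the whole reversed sweep; with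
  the one remaining sweep it forms the loop of \<open>garside_square\<close>.\<close>

lemma sweep_power: "[1..<m] \<up> m \<doteq> garside m @ garside m"
proof (induction m)
  case 0
  then show ?case by (simp add: braid_eq.refl)
next
  case (Suc m)
  have "[1..<Suc m] \<up> Suc m = [] @ [1..<Suc m] \<up> m @ [1..<Suc m]"
    by (simp only: word_pow_Suc_right append_Nil)
  also have "\<dots> \<doteq> [] @ ([1..<m] \<up> m @ rev [Suc m - m..<Suc m]) @ [1..<Suc m]"
    by (intro braid_eq_context sweep_power_drop) simp
  also have "\<dots> = [] @ [1..<m] \<up> m @ rev [1..<Suc m] @ [1..<Suc m]" by simp
  also have "\<dots> \<doteq> [] @ (garside m @ garside m) @ rev [1..<Suc m] @ [1..<Suc m]"
    by (intro braid_eq_context Suc.IH)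
  also have "\<dots> = garside m @ garside m @ rev [1..<Suc m] @ [1..<Suc m]"
    by (simp only: append_Nil append_assoc)
  also have "\<dots> \<doteq> garside (Suc m) @ garside (Suc m)"
    by (intro braid_eq.sym[OF garside_square])
  finally show ?case .
qed

text \<open>The doubled last letters accumulate in an ascending tail that grows by one letter per
  factor. After m - 1 factors the tail is a full sweep and serves as the m-th factor in
  \<open>sweep_power\<close>.\<close>

lemma sweep_double_power:
  assumes "r < m"
  shows "([1..<m] @ [m - 1]) \<up> r \<doteq> [1..<m] \<up> r @ [m - r..<m]"
  using assms
proof (induction r)
  case 0
  then show ?case by (simp add: braid_eq.refl)
next
  case (Suc r)
  let ?A = "[1..<m]"
  have "(?A @ [m - 1]) \<up> Suc r = [] @ (?A @ [m - 1]) \<up> r @ (?A @ [m - 1])"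
    by (simp only: word_pow_Suc_right append_Nil)
  also have "\<dots> \<doteq> [] @ (?A \<up> r @ [m - r..<m]) @ (?A @ [m - 1])"
    using Suc by (intro braid_eq_context) simp
  also have "\<dots> = ?A \<up> r @ (map Suc [m - Suc r..<m - 1] @ ?A) @ [m - 1]"
    using Suc.prems by (simp add: map_Suc_upt Suc_diff_Suc)
  also have "\<dots> \<doteq> ?A \<up> r @ (?A @ [m - Suc r..<m - 1]) @ [m - 1]"
    using Suc.prems by (intro braid_eq_context sweep_push) auto
  also have "[m - Suc r..<m] = [m - Suc r..<m - 1] @ [m - 1]"
    using Suc.prems upt_Suc_append[of "m - Suc r" "m - 1"] by simp
  then have "?A \<up> r @ (?A @ [m - Suc r..<m - 1]) @ [m - 1] = ?A \<up> Suc r @ [m - Suc r..<m]"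
    by (simp only: word_pow_Suc_right append_assoc)
  finally show ?case .
qed

lemma sweep_double_power_full:
  assumes "1 \<le> m"
  shows "([1..<m] @ [m - 1]) \<up> (m - 1) \<doteq> garside m @ garside m"
proof -
  have "([1..<m] @ [m - 1]) \<up> (m - 1) \<doteq> [1..<m] \<up> (m - 1) @ [m - (m - 1)..<m]"
    using assms by (intro sweep_double_power) simp
  also have "\<dots> = [1..<m] \<up> Suc (m - 1)"
    using assms by (simp only: word_pow_Suc_right) simp
  also have "\<dots> \<doteq> garside m @ garside m"
    using assms sweep_power[of m] by simp
  finally show ?thesis .
qed

section \<open>Crossing numbers modulo 4\<close>

fun strand :: "nat group_word \<Rightarrow> nat \<Rightarrow> nat" where
  "strand [] a = a"
| "strand ((i, e) # w) a = strand w (Transposition.transpose i (Suc i) a)"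

text \<open>Strands are named by their positions before the braid, and words are read from left to
  right.\<close>

fun crossings :: "nat group_word \<Rightarrow> nat \<Rightarrow> nat \<Rightarrow> int" where
  "crossings [] a b = 0"
| "crossings ((i, e) # w) a b =
    (if {a, b} = {i, Suc i} then if e then -1 else 1 else 0) +
    crossings w (Transposition.transpose i (Suc i) a) (Transposition.transpose i (Suc i) b)"

text \<open>The exponent sum of the braid on three strands that remains when all other strands are
  forgotten.\<close>

definition crossings3 :: "nat group_word \<Rightarrow> nat \<Rightarrow> nat \<Rightarrow> nat \<Rightarrow> int"
  where "crossings3 w a b c = crossings w a b + crossings w b c + crossings w a c"

lemma strand_append: "strand (u @ v) a = strand v (strand u a)"
  by (induction u a rule: strand.induct) auto

lemma crossings_append:
  "crossings (u @ v) a b = crossings u a b + crossings v (strand u a) (strand u b)"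
  by (induction u a b rule: crossings.induct) auto

lemma crossings3_append:
  "crossings3 (u @ v) a b c =
    crossings3 u a b c + crossings3 v (strand u a) (strand u b) (strand u c)"
  by (simp add: crossings3_def crossings_append)

lemma inj_strand: "strand w a = strand w b \<longleftrightarrow> a = b"
proof (induction w a arbitrary: b rule: strand.induct)
  case (2 i e w a)
  then show ?case by (simp add: inj_eq[OF inj_on_transpose])
qed simp

lemma transpose_in_range:
  "i \<in> {1..<n} \<Longrightarrow> a \<in> {1..n} \<Longrightarrow> Transposition.transpose i (Suc i) a \<in> {1..n}"
  by (auto simp: Transposition.transpose_def)

lemma strand_in_range: "w \<in> words {1..<n} \<Longrightarrow> a \<in> {1..n} \<Longrightarrow> strand w a \<in> {1..n}"
proof (induction w a rule: strand.induct)
  case (2 i e w a)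
  then have "i \<in> {1..<n}" "w \<in> words {1..<n}" by (auto simp: words_def)
  then show ?case using 2 transpose_in_range[of i n a] by simp
qed simp

lemma strand_palindrome: "strand (pos_word (xs @ rev xs)) a = a"
  by (induction xs arbitrary: a) (simp_all add: strand_append)

text \<open>Moves a transposition from the unknown strands to the known positions of a crossing,
  where it can be computed.\<close>

lemma transpose_doubleton:
  "{Transposition.transpose i j a, Transposition.transpose i j b} = {c, d}
    \<longleftrightarrow> {a, b} = {Transposition.transpose i j c, Transposition.transpose i j d}"
proof -
  let ?t = "Transposition.transpose i j"
  have "?t ` ?t ` A = A" for A by (simp add: image_image)
  then have "?t ` {a, b} = {c, d} \<longleftrightarrow> {a, b} = ?t ` {c, d}" by metis
  then show ?thesis by simp
qed

text \<open>The second half retraces the positions of the first, and as all letters are positive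
  each crossing is met again with the same sign.\<close>

lemma crossings_palindrome:
  "crossings (pos_word (xs @ rev xs)) a b = 2 * crossings (pos_word xs) a b"
proof (induction xs arbitrary: a b)
  case (Cons i xs)
  let ?t = "Transposition.transpose i (Suc i)"
  have "strand (pos_word (xs @ rev xs)) c = c" for c by (rule strand_palindrome)
  then show ?case
    using Cons.IH[of "?t a" "?t b"]
    by (simp add: crossings_append strand_append transpose_doubleton insert_commute)
qed simp

lemma strand_sweep:
  "strand (pos_word [b..<m]) a =
    (if a = b \<and> b \<le> m then m else if b < a \<and> a \<le> m then a - 1 else a)"
proof (induction m)
  case (Suc m)
  then show ?case
    by (cases "b \<le> m") (auto simp: strand_append Transposition.transpose_def)
qed simp

lemma strand_top: "set w \<subseteq> {..<m} \<times> UNIV \<Longrightarrow> strand w (Suc m) = Suc m"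
proof (induction w)
  case (Cons p w)
  then show ?case by (cases p) auto
qed simp

text \<open>A letter below m exchanges two positions that are at most m, so the strand at
  \<open>Suc m\<close> stays there and meets no other strand.\<close>

lemma crossings_top:
  assumes "set w \<subseteq> {..<m} \<times> UNIV"
  shows "crossings w a (Suc m) = 0" "crossings w (Suc m) a = 0"
  using assms
proof (induction w arbitrary: a)
  case (Cons p w)
  obtain i e where p: "p = (i, e)" by (cases p)
  {
    case 1
    then show ?case using Cons.IH p by (auto simp: doubleton_eq_iff)
  next
    case 2
    then show ?case using Cons.IH p by (auto simp: doubleton_eq_iff)
  }
qed simp_all

lemma low_garside: "set (pos_word (garside m)) \<subseteq> {..<m} \<times> UNIV"
  using set_garside[of m] by auto

lemma crossings_sweep:
  assumes "a \<in> {1..m}" "b \<in> {1..m}" "a \<noteq> b"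
  shows "crossings (pos_word [1..<m]) a b = (if a = 1 \<or> b = 1 then 1 else 0)"
  using assms
proof (induction m)
  case (Suc m)
  show ?case
  proof (cases "m = 0")
    case False
    have low: "set (pos_word [1..<m]) \<subseteq> {..<m} \<times> UNIV" by auto
    have step: "crossings (pos_word [1..<Suc m]) a b = crossings (pos_word [1..<m]) a b
      + (if {strand (pos_word [1..<m]) a, strand (pos_word [1..<m]) b} = {m, Suc m} then 1 else 0)"
      using False by (simp add: crossings_append)
    consider "a = Suc m" "b \<le> m" | "a \<le> m" "b = Suc m" | "a \<le> m" "b \<le> m"
      using Suc.prems by fastforce
    then show ?thesis
    proof cases
      case 1
      then show ?thesis
        unfolding step using Suc.prems False crossings_top[OF low]
        by (auto simp: strand_sweep doubleton_eq_iff)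
    next
      case 2
      then show ?thesis
        unfolding step using Suc.prems False crossings_top[OF low]
        by (auto simp: strand_sweep doubleton_eq_iff)
    next
      case 3
      \<comment> \<open>The new letter exchanges the positions m and \<open>Suc m\<close>, and
        neither strand has reached \<open>Suc m\<close>.\<close>
      then have "strand (pos_word [1..<m]) a \<le> m" "strand (pos_word [1..<m]) b \<le> m"
        using strand_sweep[of 1 m] by auto
      then have "{strand (pos_word [1..<m]) a, strand (pos_word [1..<m]) b} \<noteq> {m, Suc m}"
        by (auto simp: doubleton_eq_iff)
      then show ?thesis unfolding step using 3 Suc by simp
    qed
  qed (use Suc in auto)
qed simp

lemma strand_garside: "a \<in> {1..m} \<Longrightarrow> strand (pos_word (garside m)) a = m + 1 - a"
proof (induction m arbitrary: a)
  case (Suc m)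
  have fix_top: "strand (pos_word (garside m)) (Suc m) = Suc m"
    using strand_top[OF low_garside] .
  show ?case
  proof (cases "a = 1")
    case True
    then show ?thesis using fix_top by (simp add: strand_append strand_sweep del: upt_Suc)
  next
    case False
    then have "a - 1 \<in> {1..m}" using Suc.prems by auto
    then show ?thesis
      using False Suc by (auto simp: strand_append strand_sweep simp del: upt_Suc)
  qed
qed simp

text \<open>The leading sweep carries strand 1 once past all others to the top, where the inner half
  twist does not touch it; the other pairs are left to the induction.\<close>

lemma crossings_garside:
  "a \<in> {1..m} \<Longrightarrow> b \<in> {1..m} \<Longrightarrow> a \<noteq> b \<Longrightarrow> crossings (pos_word (garside m)) a b = 1"
proof (induction m arbitrary: a b)
  case (Suc m)
  have "crossings (pos_word (garside (Suc m))) a b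
      = crossings (pos_word [1..<Suc m]) a b
        + crossings (pos_word (garside m)) (strand (pos_word [1..<Suc m]) a)
            (strand (pos_word [1..<Suc m]) b)"
    by (simp add: crossings_append del: upt_Suc)
  also have "\<dots> = 1"
  proof (cases "a = 1 \<or> b = 1")
    case True
    then have "strand (pos_word [1..<Suc m]) a = Suc m \<or> strand (pos_word [1..<Suc m]) b = Suc m"
      using strand_sweep[of 1 "Suc m"] by auto
    moreover have "crossings (pos_word [1..<Suc m]) a b = 1"
      using True crossings_sweep[OF Suc.prems] by simp
    ultimately show ?thesis using crossings_top[OF low_garside] by auto
  next
    case False
    then have "a - 1 \<in> {1..m}" "b - 1 \<in> {1..m}" "a - 1 \<noteq> b - 1" using Suc.prems by auto
    then have "crossings (pos_word (garside m)) (a - 1) (b - 1) = 1" by (rule Suc.IH)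
    moreover have "strand (pos_word [1..<Suc m]) a = a - 1" "strand (pos_word [1..<Suc m]) b = b - 1"
      using False Suc.prems strand_sweep[of 1 "Suc m"] by auto
    ultimately show ?thesis
      using False crossings_sweep[OF Suc.prems] by simp
  qed
  finally show ?case .
qed simp

text \<open>The relations of the plane preserve the crossings of every single pair. In the sphere
  relation strand 1 crosses each other strand twice, so a triple picks up 4 if it contains strand 1
  and 0 otherwise; this is where the modulus comes from.\<close>

lemma braid_relation_invariant:
  assumes "(u, v) \<in> sphere_braid_rels n"
  shows "strand u = strand v"
    and "a \<in> {1..n} \<Longrightarrow> b \<in> {1..n} \<Longrightarrow> c \<in> {1..n} \<Longrightarrow> distinct [a, b, c] \<Longrightarrow>
      crossings3 u a b c mod 4 = crossings3 v a b c mod 4"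
proof -
  consider
    (far) i j where "u = pos_word [i, j]" "v = pos_word [j, i]" "\<bar>int i - int j\<bar> \<ge> 2"
  | (near) i where "u = pos_word [i, i + 1, i]" "v = pos_word [i + 1, i, i + 1]"
  | (sphere) "u = pos_word ([1..<n] @ rev [1..<n])" "v = []"
    using assms unfolding sphere_braid_rels_def by blast
  then have "strand u = strand v \<and> (a \<in> {1..n} \<longrightarrow> b \<in> {1..n} \<longrightarrow> c \<in> {1..n} \<longrightarrow>
      distinct [a, b, c] \<longrightarrow> crossings3 u a b c mod 4 = crossings3 v a b c mod 4)"
  proof cases
    case far
    have "strand u d = strand v d" for d
      using far by (auto simp: Transposition.transpose_def)
    moreover have "crossings u d e = crossings v d e" for d e
    proof -
      have "Transposition.transpose i (Suc i) j = j" "Transposition.transpose i (Suc i) (Suc j) = Suc j"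
        "Transposition.transpose j (Suc j) i = i" "Transposition.transpose j (Suc j) (Suc i) = Suc i"
        using far(3) by (auto simp: Transposition.transpose_def)
      then show ?thesis using far(1,2) by (simp add: transpose_doubleton)
    qed
    ultimately show ?thesis by (simp add: fun_eq_iff crossings3_def)
  next
    case near
    have "strand u d = strand v d" for d
      using near by (auto simp: Transposition.transpose_def)
    moreover have "crossings u d e = crossings v d e" for d e
      using near
      by (simp add: transpose_doubleton transpose_apply_other insert_commute)
    ultimately show ?thesis by (simp add: fun_eq_iff crossings3_def)
  next
    case sphere
    have "strand u d = strand v d" for d
      using sphere by (simp only: strand_palindrome strand.simps)
    moreover have "crossings u d e = 2 * (if d = 1 \<or> e = 1 then 1 else 0)"
      if "d \<in> {1..n}" "e \<in> {1..n}" "d \<noteq> e" for d e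
      using crossings_sweep[OF that] sphere(1) by (simp only: crossings_palindrome)
    ultimately show ?thesis
      using sphere by (auto simp: crossings3_def)
  qed
  then show "strand u = strand v"
    and "a \<in> {1..n} \<Longrightarrow> b \<in> {1..n} \<Longrightarrow> c \<in> {1..n} \<Longrightarrow> distinct [a, b, c] \<Longrightarrow>
      crossings3 u a b c mod 4 = crossings3 v a b c mod 4"
    by auto
qed

lemma sphere_braid_invariant:
  assumes "pres_eq {1..<n} (sphere_braid_rels n) u v"
  shows "strand u = strand v \<and>
    (\<forall>a\<in>{1..n}. \<forall>b\<in>{1..n}. \<forall>c\<in>{1..n}. distinct [a, b, c] \<longrightarrow>
      crossings3 u a b c mod 4 = crossings3 v a b c mod 4)"
  using assms
proof (induction rule: pres_eq.induct)
  case (refl w)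
  then show ?case by simp
next
  case (sym u v)
  then show ?case by simp
next
  case (trans u v w)
  then show ?case by metis
next
  case (append u u' v v')
  \<comment> \<open>The second factor sees the strands at their new positions, which must again be
    in range and distinct before the hypothesis about it applies.\<close>
  have "u \<in> words {1..<n}" using append.hyps(1) pres_eq_words by blast
  then have "strand u a \<in> {1..n}" if "a \<in> {1..n}" for a
    using strand_in_range that by blast
  then show ?case
    using append.IH
    by (auto simp: strand_append crossings3_append fun_eq_iff inj_strand simp del: atLeastAtMost_iff
        intro!: mod_add_cong)
next
  case (cancel i e)
  have "strand [(i, e), (i, \<not> e)] = strand []" by (simp add: fun_eq_iff)
  moreover have "crossings [(i, e), (i, \<not> e)] a b = 0" for a b
    by (simp add: transpose_doubleton insert_commute)
  ultimately show ?case by (simp add: crossings3_def)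
next
  case (rel u v)
  then show ?case using braid_relation_invariant[OF rel(1)] by simp
qed

section \<open>Dicyclic groups\<close>

fun eval_word :: "('b, 'm) monoid_scheme \<Rightarrow> ('a \<Rightarrow> 'b) \<Rightarrow> 'a group_word \<Rightarrow> 'b" where
  "eval_word H f [] = \<one>\<^bsub>H\<^esub>"
| "eval_word H f ((a, e) # w) = (if e then inv\<^bsub>H\<^esub> f a else f a) \<otimes>\<^bsub>H\<^esub> eval_word H f w"

lemma carrier_presented_group: "carrier (presented_group S R) = word_class S R ` words S"
  by (simp add: presented_group_def)

lemma one_presented_group: "\<one>\<^bsub>presented_group S R\<^esub> = word_class S R []"
  by (simp add: presented_group_def)

text \<open>Von Dyck's theorem. The map evaluates an arbitrary representative of a class, and is
  well defined because evaluation respects every rule of the congruence.\<close>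

lemma presented_group_universal:
  assumes "group H"
    and f: "\<And>a. a \<in> S \<Longrightarrow> f a \<in> carrier H"
    and rels: "\<And>u v. (u, v) \<in> R \<Longrightarrow> u \<in> words S \<Longrightarrow> v \<in> words S \<Longrightarrow>
      eval_word H f u = eval_word H f v"
  obtains h where "h \<in> hom (presented_group S R) H"
    and "\<And>w. w \<in> words S \<Longrightarrow> h (word_class S R w) = eval_word H f w"
proof -
  interpret H: group H by fact
  have closed: "w \<in> words S \<Longrightarrow> eval_word H f w \<in> carrier H" for w
    using f by (induction w) (auto simp: words_def)
  have app: "u \<in> words S \<Longrightarrow> v \<in> words S \<Longrightarrow>
      eval_word H f (u @ v) = eval_word H f u \<otimes>\<^bsub>H\<^esub> eval_word H f v" for u v
  proof (induction u)
    case (Cons p u)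
    obtain a e where p: "p = (a, e)" by (cases p)
    then have "f a \<in> carrier H" "u \<in> words S" using Cons.prems f by (auto simp: words_def)
    then show ?case
      using p Cons closed[of u] closed[of v] by (simp add: H.m_assoc)
  qed (simp add: closed)
  have inv: "eval_word H f u = eval_word H f v" if "pres_eq S R u v" for u v
    using that
  proof (induction rule: pres_eq.induct)
    case (append u u' v v')
    then show ?case using pres_eq_words[OF append.hyps(1)] pres_eq_words[OF append.hyps(2)] app
      by simp
  next
    case (cancel a e)
    then show ?case using f by simp
  next
    case (rel u v)
    then show ?case using rels by blast
  qed simp_all
  define h where "h A = eval_word H f (SOME w. w \<in> A)" for A
  have h: "h (word_class S R w) = eval_word H f w" if "w \<in> words S" for w
  proof -
    have "w \<in> word_class S R w" using that by (simp add: word_class_def pres_eq.refl)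
    then have "(SOME w'. w' \<in> word_class S R w) \<in> word_class S R w" by (rule someI)
    then show ?thesis unfolding h_def by (simp add: inv word_class_def)
  qed
  have "h \<in> hom (presented_group S R) H"
  proof (rule homI)
    fix A B assume "A \<in> carrier (presented_group S R)" "B \<in> carrier (presented_group S R)"
    then obtain u v where "u \<in> words S" "v \<in> words S" "A = word_class S R u" "B = word_class S R v"
      by (auto simp: carrier_presented_group)
    moreover from this have "u @ v \<in> words S" by (simp add: words_def)
    ultimately show "h (A \<otimes>\<^bsub>presented_group S R\<^esub> B) = h A \<otimes>\<^bsub>H\<^esub> h B"
      by (simp add: word_class_mult h app)
  qed (auto simp: carrier_presented_group h closed)
  then show thesis using h that by blast
qed

lemma word_class_inv:
  assumes "a \<in> S"
  shows "inv\<^bsub>presented_group S R\<^esub> word_class S R [pos_letter a] = word_class S R [neg_letter a]"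
proof -
  interpret group "presented_group S R" by (rule group_presented_group)
  have "[pos_letter a] \<in> words S" "[neg_letter a] \<in> words S" "[neg_letter a, pos_letter a] \<in> words S"
    using assms by (auto simp: words_def)
  moreover have "pres_eq S R [neg_letter a, pos_letter a] []"
    using pres_eq.cancel[OF assms, of R True] by simp
  ultimately show ?thesis
    by (intro inv_equality)
      (auto simp: carrier_presented_group one_presented_group word_class_mult word_class_eq_iff)
qed

text \<open>Together with \<open>generate_dicyclic\<close> this brings every element of
  \<open>Dic\<close> into normal form.\<close>

lemma generate_presented_group:
  "generate (presented_group S R) ((\<lambda>a. word_class S R [pos_letter a]) ` S)
    = carrier (presented_group S R)"
proof -
  let ?P = "presented_group S R" and ?g = "\<lambda>a. word_class S R [pos_letter a]"
  interpret group ?P by (rule group_presented_group)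
  have "word_class S R w \<in> generate ?P (?g ` S)" if "w \<in> words S" for w
    using that
  proof (induction w)
    case Nil
    then show ?case using generate.one[of ?P] by (simp add: one_presented_group)
  next
    case (Cons p w)
    obtain a e where p: "p = (a, e)" by (cases p)
    have a: "a \<in> S" and w: "w \<in> words S" and "[p] \<in> words S"
      using Cons.prems p by (auto simp: words_def)
    then have "word_class S R (p # w) = word_class S R [p] \<otimes>\<^bsub>?P\<^esub> word_class S R w"
      by (simp add: word_class_mult)
    moreover have "word_class S R [p] \<in> generate ?P (?g ` S)"
      using a p generate.incl[of "?g a" "?g ` S" ?P] generate.inv[of "?g a" "?g ` S" ?P]
      by (cases e) (auto simp: word_class_inv)
    ultimately show ?case using Cons.IH[OF w] by (simp add: generate.eng)
  qed
  moreover have "?g ` S \<subseteq> carrier ?P" by (auto simp: carrier_presented_group words_def)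
  ultimately show ?thesis
    using generate_incl[of "?g ` S"] by (auto simp only: carrier_presented_group)
qed

section \<open>Normal forms in dicyclic groups\<close>

context group
begin

lemma inverting_int_pow:
  assumes [simp]: "u \<in> carrier G" "v \<in> carrier G" and vu: "v \<otimes> u = inv u \<otimes> v"
  shows "v \<otimes> u [^] (a::int) = u [^] (- a) \<otimes> v"
proof -
  have nat: "v \<otimes> u [^] (n::nat) = inv u [^] n \<otimes> v" for n
  proof (induction n)
    case (Suc n)
    have "v \<otimes> u [^] Suc n = (v \<otimes> u [^] n) \<otimes> u" by (simp add: m_assoc)
    also have "\<dots> = inv u [^] n \<otimes> (v \<otimes> u)" by (simp add: Suc.IH m_assoc)
    also have "\<dots> = inv u [^] Suc n \<otimes> v" by (simp add: vu m_assoc)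
    finally show ?case .
  qed simp
  show ?thesis
  proof (cases a rule: int_cases2)
    case (nonneg n)
    then show ?thesis using nat[of n] by (simp add: int_pow_neg int_pow_int nat_pow_inv)
  next
    case (nonpos n)
    have "v = inv u [^] n \<otimes> v \<otimes> inv (u [^] n)"
      by (simp add: nat[of n, symmetric] m_assoc)
    then have "u [^] n \<otimes> v = u [^] n \<otimes> (inv (u [^] n) \<otimes> v \<otimes> inv (u [^] n))"
      by (simp add: nat_pow_inv)
    also have "\<dots> = v \<otimes> inv (u [^] n)" by (simp add: m_assoc[symmetric])
    finally show ?thesis using nonpos by (simp add: int_pow_neg int_pow_int)
  qed
qed

lemma dicyclic_mult:
  fixes a b :: int and m :: nat
  assumes [simp]: "u \<in> carrier G" "v \<in> carrier G" and vu: "v \<otimes> u = inv u \<otimes> v"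
    and um: "u [^] m = v \<otimes> v"
  shows "u [^] a \<otimes> (u [^] b \<otimes> v) = u [^] (a + b) \<otimes> v"
    and "(u [^] a \<otimes> v) \<otimes> u [^] b = u [^] (a - b) \<otimes> v"
    and "(u [^] a \<otimes> v) \<otimes> (u [^] b \<otimes> v) = u [^] (a - b + int m)"
proof -
  show "u [^] a \<otimes> (u [^] b \<otimes> v) = u [^] (a + b) \<otimes> v"
    by (simp add: m_assoc[symmetric] int_pow_mult)
  have *: "(u [^] a \<otimes> v) \<otimes> u [^] b = u [^] (a - b) \<otimes> v" for a b :: int
  proof -
    have "(u [^] a \<otimes> v) \<otimes> u [^] b = u [^] a \<otimes> (u [^] (- b) \<otimes> v)"
      by (simp add: m_assoc inverting_int_pow vu)
    also have "\<dots> = u [^] (a - b) \<otimes> v"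
      using int_pow_mult[of u a "- b"] by (simp add: m_assoc[symmetric])
    finally show ?thesis .
  qed
  then show "(u [^] a \<otimes> v) \<otimes> u [^] b = u [^] (a - b) \<otimes> v" .
  have "(u [^] a \<otimes> v) \<otimes> (u [^] b \<otimes> v) = ((u [^] a \<otimes> v) \<otimes> u [^] b) \<otimes> v"
    by (simp add: m_assoc)
  also have "\<dots> = u [^] (a - b) \<otimes> u [^] int m"
    by (simp add: * m_assoc um int_pow_int)
  also have "\<dots> = u [^] (a - b + int m)" by (simp add: int_pow_mult)
  finally show "(u [^] a \<otimes> v) \<otimes> (u [^] b \<otimes> v) = u [^] (a - b + int m)" .
qed

text \<open>As u^m is v^2, it commutes with v; but v also inverts it, so u^m is its own
  inverse.\<close>

lemma dicyclic_order:
  fixes m :: nat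
  assumes [simp]: "u \<in> carrier G" "v \<in> carrier G" and vu: "v \<otimes> u = inv u \<otimes> v"
    and um: "u [^] m = v \<otimes> v"
  shows "u [^] (2 * m) = \<one>"
proof -
  have "u [^] int m \<otimes> v = v \<otimes> u [^] int m"
    by (simp add: int_pow_int um m_assoc)
  also have "\<dots> = u [^] (- int m) \<otimes> v" by (rule inverting_int_pow) (simp_all add: vu)
  finally have "u [^] int m = u [^] (- int m)" by (simp add: r_cancel)
  then have "int (ord u) dvd - int m - int m" by (simp add: int_pow_eq)
  then have "int (ord u) dvd int (2 * m)"
    by (metis dvd_minus_iff minus_diff_commute minus_diff_eq mult_2 of_nat_add diff_minus_eq_add)
  then show ?thesis by (simp only: pow_eq_id int_dvd_int_iff assms)
qed

lemma generate_dicyclic: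
  fixes m :: nat
  assumes [simp]: "u \<in> carrier G" "v \<in> carrier G" and vu: "v \<otimes> u = inv u \<otimes> v"
    and um: "u [^] m = v \<otimes> v"
  shows "generate G {u, v} = range (\<lambda>a::int. u [^] a) \<union> range (\<lambda>a::int. u [^] a \<otimes> v)"
    (is "_ = ?D")
proof (rule equalityI)
  have "subgroup ?D G"
  proof (rule subgroupI)
    fix g assume "g \<in> ?D"
    then consider (rot) a :: int where "g = u [^] a" | (flip) a :: int where "g = u [^] a \<otimes> v"
      by auto
    then show "inv g \<in> ?D"
    proof cases
      case rot
      then have "inv g = u [^] (- a)" by (simp add: int_pow_neg)
      then show ?thesis by blast
    next
      case flip
      \<comment> \<open>The exponents combine to (a + m) - a + m = 2m, so u^(a+m) v is a left
        inverse of u^a v.\<close>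
      have "(u [^] (a + int m) \<otimes> v) \<otimes> g = u [^] (2 * int m)"
        unfolding flip by (simp add: dicyclic_mult[OF _ _ vu um])
      also have "\<dots> = \<one>"
        using dicyclic_order[OF _ _ vu um] by (metis assms(1,2) int_pow_int of_nat_mult of_nat_numeral)
      finally have "inv g = u [^] (a + int m) \<otimes> v" using flip by (intro inv_equality) auto
      then show ?thesis by blast
    qed
  next
    fix g g' assume "g \<in> ?D" "g' \<in> ?D"
    then show "g \<otimes> g' \<in> ?D"
      by (auto simp: dicyclic_mult[OF _ _ vu um] int_pow_mult[symmetric])
  qed auto
  moreover have "u \<in> ?D" "v \<in> ?D"
    using range_eqI[of u "\<lambda>a::int. u [^] a" 1] range_eqI[of v "\<lambda>a::int. u [^] a \<otimes> v" 0]
    by (simp_all add: int_pow_1)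
  ultimately show "generate G {u, v} \<subseteq> ?D" by (intro generate_subgroup_incl) auto
next
  have *: "subgroup (generate G {u, v}) G" by (intro generate_is_subgroup) auto
  have uv: "u \<in> generate G {u, v}" "v \<in> generate G {u, v}" by (auto intro: generate.incl)
  then have "u [^] (a::int) \<in> generate G {u, v}" for a
    using * subgroup_int_pow_closed by blast
  then show "?D \<subseteq> generate G {u, v}" using uv by (auto intro: generate.eng)
qed

text \<open>\<open>Dic (4 * m)\<close> maps onto \<open>\<langle>u, v\<rangle>\<close>, and its elements are of the form \<open>U\<^sup>a\<close> or
  \<open>U\<^sup>a V\<close>, so it suffices to exclude nontrivial kernel elements of these two shapes.\<close>

lemma generate_iso_Dic:
  fixes m :: nat
  assumes u [simp]: "u \<in> carrier G" and v [simp]: "v \<in> carrier G"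
    and vu: "v \<otimes> u = inv u \<otimes> v"
    and um: "u [^] m = v \<otimes> v"
    and ord: "ord u = 2 * m"
    and notin: "v \<notin> range (\<lambda>a::int. u [^] a)"
  shows "G\<lparr>carrier := generate G {u, v}\<rparr> \<cong> Dic (4 * m)"
proof -
  define f where "f = case_dic_gen u v"
  define D where "D = Dic (4 * m)"
  have D: "D = presented_group UNIV (dic_rels m)" by (simp add: D_def Dic_def)
  interpret D: group D unfolding D by (rule group_presented_group)
  let ?c = "word_class UNIV (dic_rels m)"
  have repl: "eval_word G f (pos_word (replicate r Dic_u)) = u [^] r" for r
    by (induction r) (simp_all add: f_def nat_pow_Suc2[OF u, symmetric])
  obtain h where h: "h \<in> hom D G" and h_eval: "\<And>w. h (?c w) = eval_word G f w"
  proof (rule presented_group_universal[of G UNIV f "dic_rels m"])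
    show "group G" by (rule is_group)
    show "f a \<in> carrier G" for a by (cases a) (simp_all add: f_def)
    show "eval_word G f w = eval_word G f w'" if "(w, w') \<in> dic_rels m" for w w'
    proof -
      have "v \<otimes> (u \<otimes> inv v) = inv u"
        using vu by (metis inv_closed m_assoc r_inv r_one u v)
      moreover have "eval_word G f (pos_word (replicate m Dic_u)) = v \<otimes> v"
        by (simp only: repl um)
      ultimately show ?thesis
        using that by (auto simp: dic_rels_def f_def)
    qed
  qed (auto simp: D words_def)
  interpret h: group_hom D G h using h by unfold_locales
  define U V where "U = ?c [pos_letter Dic_u]" and "V = ?c [pos_letter Dic_v]"
  have UV: "U \<in> carrier D" "V \<in> carrier D"
    by (auto simp: U_def V_def D carrier_presented_group words_def)
  have c_mult: "?c w \<otimes>\<^bsub>D\<^esub> ?c w' = ?c (w @ w')" for w w'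
    by (simp add: D word_class_mult words_def)
  have c_rel: "?c w = ?c w'" if "(w, w') \<in> dic_rels m" for w w'
    using that by (simp add: word_class_eq_iff words_def pres_eq.rel)
  have U_inv: "inv\<^bsub>D\<^esub> U = ?c [neg_letter Dic_u]" and V_inv: "inv\<^bsub>D\<^esub> V = ?c [neg_letter Dic_v]"
    by (simp_all add: U_def V_def D word_class_inv)
  have "V \<otimes>\<^bsub>D\<^esub> U \<otimes>\<^bsub>D\<^esub> inv\<^bsub>D\<^esub> V = inv\<^bsub>D\<^esub> U"
    unfolding U_inv V_inv unfolding U_def V_def
    by (simp add: c_mult) (intro c_rel, simp add: dic_rels_def)
  then have VU: "V \<otimes>\<^bsub>D\<^esub> U = inv\<^bsub>D\<^esub> U \<otimes>\<^bsub>D\<^esub> V"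
    using UV by (metis D.inv_solve_right D.m_closed D.inv_closed)
  have U_pow: "U [^]\<^bsub>D\<^esub> r = ?c (pos_word (replicate r Dic_u))" for r :: nat
  proof (induction r)
    case 0
    then show ?case by (simp add: D one_presented_group)
  next
    case (Suc r)
    then show ?case
      by (simp add: U_def c_mult replicate_append_same)
  qed
  have UM: "U [^]\<^bsub>D\<^esub> m = V \<otimes>\<^bsub>D\<^esub> V"
    unfolding U_pow V_def c_mult by (intro c_rel) (simp add: dic_rels_def)
  have "(UNIV :: dic_gen set) = {Dic_u, Dic_v}" by (auto intro: dic_gen.exhaust)
  then have "range f = {f Dic_u, f Dic_v}" for f :: "dic_gen \<Rightarrow> dic_gen group_word set"
    by (metis image_empty image_insert)
  then have "range (\<lambda>a. ?c [pos_letter a]) = {U, V}"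
    by (simp add: U_def V_def)
  then have carr: "carrier D = range (\<lambda>a::int. U [^]\<^bsub>D\<^esub> a) \<union> range (\<lambda>a::int. U [^]\<^bsub>D\<^esub> a \<otimes>\<^bsub>D\<^esub> V)"
    using generate_presented_group[where S = UNIV and R = "dic_rels m"] D.generate_dicyclic[OF UV VU UM]
    by (simp add: D)
  have hU: "h U = u" and hV: "h V = v"
    by (simp_all add: U_def V_def h_eval f_def)
  have h_rot: "h (U [^]\<^bsub>D\<^esub> a) = u [^] a" for a :: int
    using UV by (simp add: hU h.hom_int_pow)
  have h_flip: "h (U [^]\<^bsub>D\<^esub> a \<otimes>\<^bsub>D\<^esub> V) = u [^] a \<otimes> v" for a :: int
    using UV by (simp add: h_rot hV)
  have "inj_on h (carrier D)"
  proof (rule h.inj_on_one_iff[THEN iffD2], intro allI impI)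
    fix g assume "g \<in> carrier D" "h g = \<one>"
    then consider (rot) a :: int where "g = U [^]\<^bsub>D\<^esub> a" "u [^] a = \<one>"
      | (flip) a :: int where "u [^] a \<otimes> v = \<one>"
      unfolding carr using h_rot h_flip by auto
    then show "g = \<one>\<^bsub>D\<^esub>"
    proof cases
      case rot
      \<comment> \<open>The relations of \<open>D\<close> force the order of \<open>U\<close> to
        divide 2m, and 2m divides \<open>a\<close> because \<open>u\<close> has order 2m in the
        target.\<close>
      have "D.ord U dvd 2 * m"
        using D.dicyclic_order[OF UV VU UM] D.pow_eq_id[OF UV(1)] by simp
      moreover have "int (2 * m) dvd a" using rot by (simp add: int_pow_eq_id ord)
      ultimately have "int (D.ord U) dvd a" by (meson dvd_trans int_dvd_int_iff)
      then show ?thesis using rot by (simp add: D.int_pow_eq_id UV)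
    next
      case flip
      then have "inv v = u [^] a" by (intro inv_equality) simp_all
      then have "v = u [^] (- a)" by (metis int_pow_neg inv_inv u v)
      then show ?thesis using notin by blast
    qed
  qed
  moreover have "h ` carrier D = generate G {u, v}"
    unfolding carr generate_dicyclic[OF u v vu um] by (simp add: image_Un image_image h_rot h_flip)
  ultimately have "h \<in> iso D (G\<lparr>carrier := generate G {u, v}\<rparr>)"
    using h by (auto simp: iso_def bij_betw_def hom_def)
  then show ?thesis unfolding D_def[symmetric] by (metis D.iso_sym is_isoI)
qed

section \<open>Dicyclic subgroups of one dicyclic group\<close>

context
  fixes x t :: 'a and N :: nat
  assumes x [simp]: "x \<in> carrier G" and t [simp]: "t \<in> carrier G"
    and tx: "t \<otimes> x = inv x \<otimes> t"
    and xN: "x [^] N = t \<otimes> t"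
    and ord_x: "ord x = 2 * N"
    and N: "N \<ge> 2"
begin

text \<open>If t were a power of x, it would commute with x as well as invert it, so x^2 would be 1;
  but the order of x is 2N, which is at least 4.\<close>

lemma not_rotation: "x [^] (a::int) \<otimes> t \<noteq> x [^] (b::int)"
proof
  assume "x [^] a \<otimes> t = x [^] b"
  then have t_eq: "t = x [^] (b - a)"
    by (metis inv_solve_left' int_pow_closed int_pow_diff int_pow_mult add.commute int_pow_neg
        uminus_add_conv_diff x t)
  have "x [^] (- 1 :: int) \<otimes> t = t \<otimes> x [^] (1::int)"
    using tx by (simp add: int_pow_neg int_pow_1)
  also have "\<dots> = x [^] (1::int) \<otimes> t"
    unfolding t_eq by (simp only: int_pow_mult[symmetric] x add.commute)
  finally have "x [^] (- 1 :: int) = x [^] (1::int)" by (simp only: r_cancel int_pow_closed x t)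
  then have "int (2 * N) dvd 1 - (- 1)" by (simp only: int_pow_eq x ord_x)
  then show False using N zdvd_imp_le by fastforce
qed

text \<open>For every c the element x^c t inverts the powers of x just as t does, and its square is
  x^N because the two occurrences of c cancel.\<close>

lemma twisted_generators:
  fixes d c m :: nat
  assumes "N = d * m"
  shows "(x [^] c \<otimes> t) \<otimes> x [^] d = inv (x [^] d) \<otimes> (x [^] c \<otimes> t)"
    and "(x [^] d) [^] m = (x [^] c \<otimes> t) \<otimes> (x [^] c \<otimes> t)"
proof -
  have "(x [^] int c \<otimes> t) \<otimes> x [^] int d = x [^] (- int d) \<otimes> (x [^] int c \<otimes> t)"
    by (simp add: dicyclic_mult[OF x t tx xN])
  then show "(x [^] c \<otimes> t) \<otimes> x [^] d = inv (x [^] d) \<otimes> (x [^] c \<otimes> t)"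
    by (simp add: int_pow_neg int_pow_int)
  have "(x [^] int c \<otimes> t) \<otimes> (x [^] int c \<otimes> t) = x [^] int (d * m)"
    by (simp add: dicyclic_mult[OF x t tx xN] assms)
  then show "(x [^] d) [^] m = (x [^] c \<otimes> t) \<otimes> (x [^] c \<otimes> t)"
    by (simp only: int_pow_int nat_pow_pow x)
qed

lemma generate_twisted:
  fixes d c :: nat
  assumes "d dvd N"
  shows "generate G {x [^] d, x [^] c \<otimes> t} =
    {x [^] (int d * a) | a. True} \<union> {x [^] (int d * a + int c) \<otimes> t | a. True}"
proof -
  obtain m where m: "N = d * m" using assms by blast
  have pow: "(x [^] d) [^] a = x [^] (int d * a)" for a :: int
    by (simp add: int_pow_pow flip: int_pow_int)
  then have "(x [^] d) [^] a \<otimes> (x [^] c \<otimes> t) = x [^] (int d * a + int c) \<otimes> t" for a :: int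
    by (simp add: int_pow_mult m_assoc int_pow_int)
  then show ?thesis
    using generate_dicyclic[of "x [^] d" "x [^] c \<otimes> t" m] twisted_generators[OF m] pow
    by (auto simp: image_def)
qed

lemma generate_twisted_iso_Dic:
  fixes d c :: nat
  assumes "d dvd N"
  shows "G\<lparr>carrier := generate G {x [^] d, x [^] c \<otimes> t}\<rparr> \<cong> Dic (4 * (N div d))"
proof -
  obtain m where m: "N = d * m" using assms by blast
  have "d \<noteq> 0" using m N by (cases d) auto
  show ?thesis
  proof (rule generate_iso_Dic)
    show "(x [^] c \<otimes> t) \<otimes> x [^] d = inv (x [^] d) \<otimes> (x [^] c \<otimes> t)"
      by (rule twisted_generators[OF m])
    show "(x [^] d) [^] (N div d) = (x [^] c \<otimes> t) \<otimes> (x [^] c \<otimes> t)"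
      using twisted_generators[OF m] m \<open>d \<noteq> 0\<close> by simp
    show "ord (x [^] d) = 2 * (N div d)"
      using ord_pow[of x d] m \<open>d \<noteq> 0\<close> by (simp add: ord_x)
    show "x [^] c \<otimes> t \<notin> range (\<lambda>a::int. (x [^] d) [^] a)"
    proof
      assume "x [^] c \<otimes> t \<in> range (\<lambda>a::int. (x [^] d) [^] a)"
      then obtain a :: int where "x [^] int c \<otimes> t = x [^] (int d * a)"
        by (auto simp: int_pow_int int_pow_pow simp flip: int_pow_int)
      then show False using not_rotation by blast
    qed
  qed auto
qed

text \<open>The exponents b of the elements x^b t in such a subgroup form one residue class modulo
  d. Exponents of x are determined modulo 2N, a multiple of d, so this class can be recovered from
  the subgroup.\<close>

lemma generate_twisted_eq_iff:
  fixes d c c' :: nat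
  assumes "d dvd N"
  shows "generate G {x [^] d, x [^] c \<otimes> t} = generate G {x [^] d, x [^] c' \<otimes> t}
    \<longleftrightarrow> int d dvd int c - int c'"
proof
  assume "generate G {x [^] d, x [^] c \<otimes> t} = generate G {x [^] d, x [^] c' \<otimes> t}"
  then have "x [^] c \<otimes> t \<in> generate G {x [^] d, x [^] c' \<otimes> t}"
    by (metis generate.incl insertI1 insertI2)
  then obtain a where "x [^] c \<otimes> t = x [^] (int d * a + int c') \<otimes> t"
    using not_rotation[of "int c", unfolded int_pow_int] unfolding generate_twisted[OF assms]
    by blast
  then have "x [^] (int d * a + int c') = x [^] int c" by (simp add: int_pow_int)
  then have "int (2 * N) dvd int c - (int d * a + int c')" by (simp only: int_pow_eq x ord_x)
  moreover have "int d dvd int (2 * N)" using assms by fastforce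
  ultimately have "int d dvd int c - (int d * a + int c')" by (rule dvd_trans[rotated])
  then have "int d dvd int c - (int d * a + int c') + int d * a" by (rule dvd_add) simp
  then show "int d dvd int c - int c'" by simp
next
  assume "int d dvd int c - int c'"
  then obtain e where e: "int c = int c' + int d * e" by (metis diff_eq_eq dvdE add.commute)
  have 1: "int d * a + int c = int d * (a + e) + int c'" for a using e by (simp add: algebra_simps)
  have 2: "int d * a + int c' = int d * (a - e) + int c" for a using e by (simp add: algebra_simps)
  have "{x [^] (int d * a + int c) \<otimes> t | a. True} = {x [^] (int d * a + int c') \<otimes> t | a. True}"
    using 1 2 by (auto; metis)
  then show "generate G {x [^] d, x [^] c \<otimes> t} = generate G {x [^] d, x [^] c' \<otimes> t}"
    by (simp only: generate_twisted[OF assms])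
qed

lemma conjugate_generate_twisted:
  fixes d c c' :: nat
  assumes "d dvd N" and c': "int c' = int c + 2 * s"
  shows "conjugate_subgroups G (generate G {x [^] d, x [^] c \<otimes> t})
    (generate G {x [^] d, x [^] c' \<otimes> t})"
proof -
  let ?g = "x [^] s"
  have rot: "?g \<otimes> x [^] b \<otimes> inv ?g = x [^] b" for b :: int
    by (simp add: int_pow_mult add.commute flip: int_pow_neg int_pow_mult)
  have flip: "?g \<otimes> (x [^] b \<otimes> t) \<otimes> inv ?g = x [^] (b + 2 * s) \<otimes> t" for b :: int
    by (simp add: dicyclic_mult[OF x t tx xN] algebra_simps flip: int_pow_neg)
  have "?g <# generate G {x [^] d, x [^] c \<otimes> t} #> inv ?g
      = (\<lambda>h. ?g \<otimes> h \<otimes> inv ?g) ` generate G {x [^] d, x [^] c \<otimes> t}"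
    by (auto simp: l_coset_def r_coset_def)
  also have "\<dots> = generate G {x [^] d, x [^] c' \<otimes> t}"
    unfolding generate_twisted[OF assms(1)] image_Un
    by (auto simp: rot flip c' image_def add.assoc)
  finally show ?thesis unfolding conjugate_subgroups_def by (intro bexI[of _ ?g]) auto
qed

text \<open>\<open>P\<close> is oddness under a homomorphism to Z/2. As d is even, the powers of x^d
  are even and all other elements have the parity of x^c t. So the subgroup has an odd element
  exactly if c plus the parity of t is odd, and conjugation preserves parity.\<close>

lemma conjugate_generate_twisted_parity:
  fixes d c c' :: nat and P :: "'a \<Rightarrow> bool"
  assumes "d dvd N" "even d"
    and P: "\<And>g h. g \<in> carrier G \<Longrightarrow> h \<in> carrier G \<Longrightarrow> P (g \<otimes> h) \<longleftrightarrow> P g \<noteq> P h"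
    and Px: "P x"
    and conj: "conjugate_subgroups G (generate G {x [^] d, x [^] c \<otimes> t})
      (generate G {x [^] d, x [^] c' \<otimes> t})"
  shows "even (int c - int c')"
proof -
  let ?H = "\<lambda>c::nat. generate G {x [^] d, x [^] c \<otimes> t}"
  obtain g where g: "g \<in> carrier G" and H: "?H c' = g <# ?H c #> inv g"
    using conj by (auto simp: conjugate_subgroups_def)
  have "\<not> P \<one>" using P[of \<one> \<one>] by simp
  then have P_inv: "P (inv h) = P h" if "h \<in> carrier G" for h
    using P[of h "inv h"] that by auto
  then have P_conj: "P (g \<otimes> h \<otimes> inv g) = P h" if "h \<in> carrier G" for h
    using that g by (auto simp: P)
  have "P (x [^] b) = odd b" for b :: nat
    using \<open>\<not> P \<one>\<close> Px by (induction b) (auto simp: P)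
  then have P_pow: "P (x [^] b) = odd b" for b :: int
    by (cases b rule: int_cases2) (simp_all add: int_pow_int int_pow_neg P_inv)
  have P_H: "P h \<longrightarrow> (odd c \<noteq> P t)" if "h \<in> ?H c" for h c
    using that \<open>even d\<close> by (auto simp: generate_twisted[OF assms(1)] P_pow P)
  have sub: "?H c \<subseteq> carrier G" for c by (intro generate_incl) auto
  have mem: "x [^] c \<otimes> t \<in> ?H c" for c by (auto intro: generate.incl)
  have P_mem: "P (x [^] c \<otimes> t) \<longleftrightarrow> (odd c \<noteq> P t)" for c :: nat
    using P_pow[of "int c"] by (simp add: P int_pow_int)
  obtain h where "h \<in> ?H c" "x [^] c' \<otimes> t = g \<otimes> h \<otimes> inv g"
    using mem[of c'] unfolding H by (auto simp: l_coset_def r_coset_def)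
  then have 1: "odd c' \<noteq> P t \<longrightarrow> odd c \<noteq> P t"
    using P_mem[of c'] P_conj[of h] P_H[of h c] sub by auto
  have "g \<otimes> (x [^] c \<otimes> t) \<otimes> inv g \<in> ?H c'"
    unfolding H using mem[of c] by (auto simp: l_coset_def r_coset_def)
  then have "odd c \<noteq> P t \<longrightarrow> odd c' \<noteq> P t"
    using P_H P_conj[of "x [^] c \<otimes> t"] P_mem[of c] by auto
  with 1 show ?thesis by auto
qed

end

end

section \<open>Dicyclic subgroups of the sphere braid group\<close>

declare One_nat_def [simp del]

section \<open>Positive words in the sphere braid group\<close>

lemma pos_word_words: "set u \<subseteq> S \<Longrightarrow> pos_word u \<in> words S"
  by (auto simp: words_def)

lemma sphere_braid_closed:
  "set u \<subseteq> {1..<n} \<Longrightarrow> sphere_braid n u \<in> carrier (sphere_braid_group n)"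
  by (simp add: sphere_braid_def sphere_braid_group_def carrier_presented_group pos_word_words)

lemma sphere_braid_append:
  "set u \<subseteq> {1..<n} \<Longrightarrow> set v \<subseteq> {1..<n} \<Longrightarrow>
    sphere_braid n (u @ v) = sphere_braid n u \<otimes>\<^bsub>sphere_braid_group n\<^esub> sphere_braid n v"
  by (simp add: sphere_braid_def sphere_braid_group_def word_class_mult pos_word_words)

lemma sphere_braid_Nil: "sphere_braid n [] = \<one>\<^bsub>sphere_braid_group n\<^esub>"
  by (simp add: sphere_braid_def sphere_braid_group_def one_presented_group)

lemma sphere_braid_word_pow:
  assumes "set u \<subseteq> {1..<n}"
  shows "sphere_braid n (u \<up> r) = sphere_braid n u [^]\<^bsub>sphere_braid_group n\<^esub> r"
proof (induction r)
  case (Suc r)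
  have "set (u \<up> r) \<subseteq> {1..<n}" using assms by (induction r) auto
  then show ?case
    using Suc assms by (simp add: word_pow_Suc_right sphere_braid_append nat_pow_def
        del: replicate.simps concat.simps)
qed (simp add: sphere_braid_Nil)

lemma pres_eq_if_braid_eq:
  assumes "u \<doteq> v" "set u \<subseteq> {1..<n}"
  shows "pres_eq {1..<n} (sphere_braid_rels n) (pos_word u) (pos_word v)"
  using assms
proof (induction rule: braid_eq.induct)
  case (refl u)
  then show ?case by (simp add: pres_eq.refl pos_word_words)
next
  case (sym u v)
  then show ?case using braid_eq_set[OF sym.hyps] by (simp add: pres_eq.sym)
next
  case (trans u v w)
  then show ?case using braid_eq_set[OF trans.hyps(1)] by (metis pres_eq.trans)
next
  case (append u u' v v')
  then show ?case by (simp add: pres_eq.append)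
next
  case (far i j)
  then have "(pos_word [i, j], pos_word [j, i]) \<in> sphere_braid_rels n"
    unfolding sphere_braid_rels_def by fastforce
  then show ?case using far by (intro pres_eq.rel) (simp_all add: words_def)
next
  case (near i)
  then have "(pos_word [i, i + 1, i], pos_word [i + 1, i, i + 1]) \<in> sphere_braid_rels n"
    unfolding sphere_braid_rels_def by fastforce
  then show ?case using near by (intro pres_eq.rel) (simp_all add: words_def)
qed

lemma sphere_braid_cong:
  "u \<doteq> v \<Longrightarrow> set u \<subseteq> {1..<n} \<Longrightarrow> sphere_braid n u = sphere_braid n v"
  by (simp add: sphere_braid_def word_class_eq_iff pos_word_words pres_eq_if_braid_eq)

lemma sphere_braid_palindrome: "sphere_braid n ([1..<n] @ rev [1..<n]) = \<one>\<^bsub>sphere_braid_group n\<^esub>"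
proof -
  have "pres_eq {1..<n} (sphere_braid_rels n) (pos_word ([1..<n] @ rev [1..<n])) []"
    by (rule pres_eq.rel) (auto simp: sphere_braid_rels_def words_def)
  moreover have "pos_word ([1..<n] @ rev [1..<n]) \<in> words {1..<n}" by (intro pos_word_words) auto
  ultimately show ?thesis
    unfolding sphere_braid_Nil[symmetric] by (simp only: sphere_braid_def word_class_eq_iff list.map)
qed

lemma half_twist_eq: "half_twist n = sphere_braid n (garside n)"
proof -
  have "concat (map (\<lambda>m. [1..<m]) (rev [2..<m + 1])) = garside m" for m
  proof (induction m)
    case (Suc m)
    then show ?case by (cases "m = 0") (auto simp: numeral_2_eq_2 One_nat_def)
  qed simp
  then show ?thesis by (simp only: half_twist_def)
qed

lemma half_twist_square_neq_one:
  assumes "n \<ge> 3"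
  shows "half_twist n \<otimes>\<^bsub>sphere_braid_group n\<^esub> half_twist n \<noteq> \<one>\<^bsub>sphere_braid_group n\<^esub>"
proof
  let ?w = "pos_word (garside n)"
  assume "half_twist n \<otimes>\<^bsub>sphere_braid_group n\<^esub> half_twist n = \<one>\<^bsub>sphere_braid_group n\<^esub>"
  then have "sphere_braid n (garside n @ garside n) = sphere_braid n []"
    by (simp add: half_twist_eq sphere_braid_append set_garside sphere_braid_Nil)
  then have "pres_eq {1..<n} (sphere_braid_rels n) (pos_word (garside n @ garside n)) []"
    using set_garside[of n]
    by (simp add: sphere_braid_def word_class_eq_iff pos_word_words del: map_append)
  from sphere_braid_invariant[OF this]
  have "crossings3 (?w @ ?w) 1 2 3 mod 4 = 0"
    using assms by (simp add: crossings3_def)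
  \<comment> \<open>Three pairs of strands, each crossing once in each of the two half
    twists.\<close>
  moreover have "crossings3 (?w @ ?w) 1 2 3 = 6"
    using assms unfolding crossings3_append
    by (simp add: crossings3_def crossings_garside strand_garside)
  ultimately show False by simp
qed

text \<open>Conjugation by the half twist reflects the letter i to n - i, so inverting
  \<open>w\<close> amounts to an identity between positive words: \<open>w\<close> followed by its
  reflection is trivial.\<close>

lemma half_twist_inverts:
  assumes w: "set w \<subseteq> {1..<n}"
    and inv: "sphere_braid n (w @ map (\<lambda>i. n - i) w) = \<one>\<^bsub>sphere_braid_group n\<^esub>"
  shows "half_twist n \<otimes>\<^bsub>sphere_braid_group n\<^esub> sphere_braid n w
    = inv\<^bsub>sphere_braid_group n\<^esub> sphere_braid n w \<otimes>\<^bsub>sphere_braid_group n\<^esub> half_twist n"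
proof -
  interpret group "sphere_braid_group n"
    unfolding sphere_braid_group_def by (rule group_presented_group)
  let ?w = "map (\<lambda>i. n - i) w"
  have w': "set ?w \<subseteq> {1..<n}" using w by fastforce
  have "garside n @ w \<doteq> ?w @ garside n"
    using w by (intro commute_map garside_flip) auto
  then have "sphere_braid n (garside n @ w) = sphere_braid n (?w @ garside n)"
    using w set_garside[of n] by (intro sphere_braid_cong) auto
  moreover have "sphere_braid n w \<otimes>\<^bsub>sphere_braid_group n\<^esub> sphere_braid n ?w = \<one>\<^bsub>sphere_braid_group n\<^esub>"
    using inv by (simp only: sphere_braid_append w w')
  then have "inv\<^bsub>sphere_braid_group n\<^esub> sphere_braid n w = sphere_braid n ?w"
    using inv_equality[OF inv_comm] sphere_braid_closed[OF w] sphere_braid_closed[OF w'] by blast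
  ultimately show ?thesis
    using w w' set_garside[of n] by (simp add: half_twist_eq sphere_braid_append)
qed

text \<open>Visible in the permutation: each factor lowers strand p by one as long as it is above
  position b, so it has not returned after r steps.\<close>

lemma sphere_braid_pow_neq_one:
  assumes w: "set w \<subseteq> {1..<n}"
    and cyc: "\<And>a. b < a \<Longrightarrow> a \<le> p \<Longrightarrow> strand (pos_word w) a = a - 1"
    and r: "0 < r" "r \<le> p - b"
  shows "sphere_braid n w [^]\<^bsub>sphere_braid_group n\<^esub> r \<noteq> \<one>\<^bsub>sphere_braid_group n\<^esub>"
proof
  assume "sphere_braid n w [^]\<^bsub>sphere_braid_group n\<^esub> r = \<one>\<^bsub>sphere_braid_group n\<^esub>"
  then have "sphere_braid n (w \<up> r) = sphere_braid n []"
    by (simp add: sphere_braid_word_pow w sphere_braid_Nil)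
  moreover have "set (w \<up> r) \<subseteq> {1..<n}" using w by (induction r) auto
  ultimately have "pres_eq {1..<n} (sphere_braid_rels n) (pos_word (w \<up> r)) []"
    by (simp add: sphere_braid_def word_class_eq_iff pos_word_words)
  then have "strand (pos_word (w \<up> r)) p = p"
    using sphere_braid_invariant by (metis strand.simps(1))
  moreover have "s \<le> p - b \<Longrightarrow> strand (pos_word (w \<up> s)) p = p - s" for s
  proof (induction s)
    case (Suc s)
    then show ?case
      by (simp only: word_pow_Suc_right map_append strand_append) (simp add: cyc)
  qed simp
  ultimately show False using r by simp
qed

text \<open>All generators go to 1 in Z/2: the commutation and braid relations preserve the length,
  and the sphere relation has the even length 2(n - 1).\<close>

lemma sphere_braid_parity:
  obtains P where
    "\<And>g h. g \<in> carrier (sphere_braid_group n) \<Longrightarrow> h \<in> carrier (sphere_braid_group n) \<Longrightarrow>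
      P (g \<otimes>\<^bsub>sphere_braid_group n\<^esub> h) \<longleftrightarrow> P g \<noteq> P h"
    and "\<And>u. set u \<subseteq> {1..<n} \<Longrightarrow> P (sphere_braid n u) \<longleftrightarrow> odd (length u)"
proof -
  let ?Z = "integer_mod_group 2"
  have eval: "eval_word ?Z (\<lambda>_. 1) w = int (length w) mod 2" for w :: "nat group_word"
  proof (induction w)
    case (Cons p w)
    then show ?case by (cases p) (auto simp: carrier_integer_mod_group mod_simps)
  qed simp
  obtain h where h: "h \<in> hom (sphere_braid_group n) ?Z"
    and h_eval: "\<And>w. w \<in> words {1..<n} \<Longrightarrow>
      h (word_class {1..<n} (sphere_braid_rels n) w) = eval_word ?Z (\<lambda>_. 1) w"
  proof (rule presented_group_universal[of ?Z "{1..<n}" "\<lambda>_. 1" "sphere_braid_rels n"])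
    show "eval_word ?Z (\<lambda>_. 1) u = eval_word ?Z (\<lambda>_. 1) v" if "(u, v) \<in> sphere_braid_rels n" for u v
      using that unfolding eval by (auto simp: sphere_braid_rels_def)
  qed (auto simp: carrier_integer_mod_group sphere_braid_group_def)
  show thesis
  proof (rule that[of "\<lambda>g. odd (h g)"])
    fix g g' assume "g \<in> carrier (sphere_braid_group n)" "g' \<in> carrier (sphere_braid_group n)"
    then show "odd (h (g \<otimes>\<^bsub>sphere_braid_group n\<^esub> g')) \<longleftrightarrow> odd (h g) \<noteq> odd (h g')"
      by (simp add: hom_mult[OF h])
  next
    fix u assume "set u \<subseteq> {1..<n}"
    then show "odd (h (sphere_braid n u)) \<longleftrightarrow> odd (length u)"
      by (simp add: sphere_braid_def h_eval pos_word_words eval)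
  qed
qed

section \<open>The two choices of x\<close>

lemma alpha0_twist:
  shows "alpha0 n \<in> carrier (sphere_braid_group n)"
    and "half_twist n \<otimes>\<^bsub>sphere_braid_group n\<^esub> alpha0 n
      = inv\<^bsub>sphere_braid_group n\<^esub> alpha0 n \<otimes>\<^bsub>sphere_braid_group n\<^esub> half_twist n"
    and "alpha0 n [^]\<^bsub>sphere_braid_group n\<^esub> n
      = half_twist n \<otimes>\<^bsub>sphere_braid_group n\<^esub> half_twist n"
    and "0 < r \<Longrightarrow> r < n \<Longrightarrow>
      alpha0 n [^]\<^bsub>sphere_braid_group n\<^esub> r \<noteq> \<one>\<^bsub>sphere_braid_group n\<^esub>"
proof -
  let ?G = "sphere_braid_group n"
  have w: "set [1..<n] \<subseteq> {1..<n}" by simp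
  show "alpha0 n \<in> carrier ?G" by (simp add: alpha0_def sphere_braid_closed)
  \<comment> \<open>Reflecting the sweep reverses it, so the identity demanded by
    \<open>half_twist_inverts\<close> is the sphere relation itself.\<close>
  have "map (\<lambda>i. n - i) [1..<n] = rev [1..<n]"
    by (rule nth_equalityI) (auto simp: rev_nth)
  then show "half_twist n \<otimes>\<^bsub>?G\<^esub> alpha0 n = inv\<^bsub>?G\<^esub> alpha0 n \<otimes>\<^bsub>?G\<^esub> half_twist n"
    unfolding alpha0_def by (intro half_twist_inverts w) (simp only: sphere_braid_palindrome)
  have "sphere_braid n ([1..<n] \<up> n) = sphere_braid n (garside n @ garside n)"
    by (intro sphere_braid_cong sweep_power) auto
  then show "alpha0 n [^]\<^bsub>?G\<^esub> n = half_twist n \<otimes>\<^bsub>?G\<^esub> half_twist n"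
    by (simp add: alpha0_def half_twist_eq sphere_braid_word_pow sphere_braid_append set_garside)
  show "alpha0 n [^]\<^bsub>?G\<^esub> r \<noteq> \<one>\<^bsub>?G\<^esub>" if "0 < r" "r < n"
    unfolding alpha0_def using that
    by (intro sphere_braid_pow_neq_one[of _ _ 1 n]) (auto simp: strand_sweep)
qed

text \<open>Conjugation by the sweep \<open>alpha0 n\<close> raises each letter up to n - 2 by one,
  and \<open>alpha2 n\<close> has only such letters. From the positive word so obtained the
  reflection, the permutation and the length of x can be read off.\<close>

lemma alpha2_conjugate_eq:
  assumes "n \<ge> 3"
  shows "alpha0 n \<otimes>\<^bsub>sphere_braid_group n\<^esub> alpha2 n \<otimes>\<^bsub>sphere_braid_group n\<^esub>
      inv\<^bsub>sphere_braid_group n\<^esub> alpha0 n = sphere_braid n ([2..<n] @ [n - 1])"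
proof -
  interpret group "sphere_braid_group n"
    unfolding sphere_braid_group_def by (rule group_presented_group)
  let ?u = "[1..<n - 2] @ [n - 2, n - 2]" and ?w = "[2..<n] @ [n - 1]"
  have u: "set ?u \<subseteq> {1..<n}" and w: "set ?w \<subseteq> {1..<n}" using assms by auto
  have "map Suc ?u = [Suc 1..<Suc (n - 2)] @ [Suc (n - 2), Suc (n - 2)]"
    by (simp add: map_Suc_upt)
  also have "Suc 1 = 2" by simp
  also have "Suc (n - 2) = n - 1" using assms by simp
  also have "[2..<n - 1] @ [n - 1, n - 1] = ?w"
    using assms upt_Suc_append[of 2 "n - 1"] by simp
  finally have Suc_u: "map Suc ?u = ?w" .
  have "map Suc ?u @ [1..<n] \<doteq> [1..<n] @ ?u"
    using assms by (intro sweep_push) auto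
  then have "?w @ [1..<n] \<doteq> [1..<n] @ ?u" unfolding Suc_u .
  then have "sphere_braid n (?w @ [1..<n]) = sphere_braid n ([1..<n] @ ?u)"
    using w by (intro sphere_braid_cong) auto
  then have "alpha0 n \<otimes>\<^bsub>sphere_braid_group n\<^esub> alpha2 n
      = sphere_braid n ?w \<otimes>\<^bsub>sphere_braid_group n\<^esub> alpha0 n"
    unfolding alpha0_def alpha2_def
    by (simp only: sphere_braid_append[OF w] sphere_braid_append[OF _ u] set_upt order_refl)
  then show ?thesis
    using w by (simp add: m_assoc sphere_braid_closed alpha0_def del: set_append)
qed

lemma alpha2_conjugate_twist:
  assumes "n \<ge> 4"
    and x_def: "x = alpha0 n \<otimes>\<^bsub>sphere_braid_group n\<^esub> alpha2 n \<otimes>\<^bsub>sphere_braid_group n\<^esub>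
      inv\<^bsub>sphere_braid_group n\<^esub> alpha0 n"
  shows "x \<in> carrier (sphere_braid_group n)"
    and "half_twist n \<otimes>\<^bsub>sphere_braid_group n\<^esub> x
      = inv\<^bsub>sphere_braid_group n\<^esub> x \<otimes>\<^bsub>sphere_braid_group n\<^esub> half_twist n"
    and "x [^]\<^bsub>sphere_braid_group n\<^esub> (n - 2)
      = half_twist n \<otimes>\<^bsub>sphere_braid_group n\<^esub> half_twist n"
    and "0 < r \<Longrightarrow> r < n - 2 \<Longrightarrow>
      x [^]\<^bsub>sphere_braid_group n\<^esub> r \<noteq> \<one>\<^bsub>sphere_braid_group n\<^esub>"
proof -
  let ?G = "sphere_braid_group n"
  interpret group ?G unfolding sphere_braid_group_def by (rule group_presented_group)
  let ?w = "[2..<n] @ [n - 1]"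
  have x: "x = sphere_braid n ?w" unfolding x_def using assms(1) by (intro alpha2_conjugate_eq) simp
  have w: "set ?w \<subseteq> {1..<n}" using assms by auto
  show carr: "x \<in> carrier ?G" unfolding x by (rule sphere_braid_closed[OF w])
  have a0: "alpha0 n \<in> carrier ?G" using alpha0_twist(1)[of n] assms(1) by simp
  have sweep: "[1..<n] = 1 # [2..<n]" using assms by (simp add: upt_conv_Cons numeral_2_eq_2)
  show "half_twist n \<otimes>\<^bsub>?G\<^esub> x = inv\<^bsub>?G\<^esub> x \<otimes>\<^bsub>?G\<^esub> half_twist n"
    unfolding x
  proof (rule half_twist_inverts[OF w])
    have 2: "set [2..<n] \<subseteq> {1..<n}" "set (rev [2..<n]) \<subseteq> {1..<n}" "set [1] \<subseteq> {1..<n}"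
      using assms by auto
    have "map (\<lambda>i. n - i) [2..<n] = rev [1..<n - 1]"
      by (rule nth_equalityI) (auto simp: rev_nth)
    then have "?w @ map (\<lambda>i. n - i) ?w = [2..<n] @ rev ([1..<n - 1] @ [n - 1]) @ [1]"
      using assms by simp
    also have "[1..<n - 1] @ [n - 1] = [1..<n]"
      using assms upt_Suc_append[of 1 "n - 1"] by simp
    finally have eq: "?w @ map (\<lambda>i. n - i) ?w = [2..<n] @ rev [2..<n] @ [1] @ [1]"
      by (simp add: sweep)
    \<comment> \<open>The sphere relation reads s c s = 1. Moving the first s to the end gives c s s
      = 1, which is the word followed by its reflection.\<close>
    let ?s = "sphere_braid n [1]" and ?c = "sphere_braid n [2..<n] \<otimes>\<^bsub>?G\<^esub> sphere_braid n (rev [2..<n])"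
    have s: "?s \<in> carrier ?G" and c: "?c \<in> carrier ?G"
      using 2 by (auto intro!: sphere_braid_closed m_closed)
    have "sphere_braid n ([1] @ [2..<n] @ rev [2..<n] @ [1]) = \<one>\<^bsub>?G\<^esub>"
      using sphere_braid_palindrome[of n] by (simp add: sweep)
    then have "?s \<otimes>\<^bsub>?G\<^esub> (?c \<otimes>\<^bsub>?G\<^esub> ?s) = \<one>\<^bsub>?G\<^esub>"
      using 2 by (simp add: sphere_braid_append m_assoc sphere_braid_closed del: append_Cons append_Nil)
    then have "?c \<otimes>\<^bsub>?G\<^esub> ?s \<otimes>\<^bsub>?G\<^esub> ?s = \<one>\<^bsub>?G\<^esub>" using inv_comm[of ?s "?c \<otimes>\<^bsub>?G\<^esub> ?s"] s c by simp
    then show "sphere_braid n (?w @ map (\<lambda>i. n - i) ?w) = \<one>\<^bsub>?G\<^esub>"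
      unfolding eq using 2
      by (simp add: sphere_braid_append m_assoc sphere_braid_closed del: append_Cons append_Nil)
  qed
  show "x [^]\<^bsub>?G\<^esub> (n - 2) = half_twist n \<otimes>\<^bsub>?G\<^esub> half_twist n"
  proof -
    \<comment> \<open>\<open>alpha2 n\<close> is a sweep on n - 1 strands with doubled last letter,
      so its power n - 2 is the full twist on n - 1 strands.\<close>
    let ?u = "[1..<n - 1] @ [n - 2]" and ?D = "garside (n - 1)" and ?R = "rev [1..<n]"
    have D: "set ?D \<subseteq> {1..<n}" using set_garside[of "n - 1"] by fastforce
    have u: "set ?u \<subseteq> {1..<n}" using assms by auto
    have R: "set ?R \<subseteq> {1..<n}" "set [1..<n] \<subseteq> {1..<n}" by auto
    have alpha2: "alpha2 n = sphere_braid n ?u"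
    proof -
      have "Suc (n - 2) = n - 1" using assms by simp
      then have "[1..<n - 1] = [1..<n - 2] @ [n - 2]"
        using assms upt_Suc_append[of 1 "n - 2"] by simp
      then show ?thesis by (simp add: alpha2_def)
    qed
    then have a2: "alpha2 n \<in> carrier ?G" using u sphere_braid_closed by metis
    have "?u \<up> (n - 2) \<doteq> ?D @ ?D"
      using sweep_double_power_full[of "n - 1"] assms by (simp add: numeral_2_eq_2)
    moreover have "set (?u \<up> (n - 2)) \<subseteq> {1..<n}" using u by auto
    ultimately have "sphere_braid n (?u \<up> (n - 2)) = sphere_braid n (?D @ ?D)"
      by (rule sphere_braid_cong)
    then have pow2: "alpha2 n [^]\<^bsub>?G\<^esub> (n - 2) = sphere_braid n ?D \<otimes>\<^bsub>?G\<^esub> sphere_braid n ?D"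
      by (simp only: alpha2 sphere_braid_word_pow[OF u] sphere_braid_append[OF D D])
    have "sphere_braid n [1..<n] \<otimes>\<^bsub>?G\<^esub> sphere_braid n ?R = \<one>\<^bsub>?G\<^esub>"
      using sphere_braid_palindrome[of n] by (simp only: sphere_braid_append R)
    \<comment> \<open>The loop of the last strand around all others is trivial, so the full twists
      on n and n - 1 strands coincide.\<close>
    then have RA: "sphere_braid n ?R \<otimes>\<^bsub>?G\<^esub> sphere_braid n [1..<n] = \<one>\<^bsub>?G\<^esub>"
      using inv_comm R sphere_braid_closed by metis
    have "garside n @ garside n \<doteq> ?D @ ?D @ ?R @ [1..<n]"
      using garside_square[of "n - 1"] assms by simp
    then have "sphere_braid n (garside n @ garside n) = sphere_braid n (?D @ ?D @ ?R @ [1..<n])"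
      using set_garside[of n] by (intro sphere_braid_cong) auto
    then have "half_twist n \<otimes>\<^bsub>?G\<^esub> half_twist n = sphere_braid n ?D \<otimes>\<^bsub>?G\<^esub> sphere_braid n ?D"
      using D R set_garside[of n] RA
      by (simp add: half_twist_eq sphere_braid_append sphere_braid_closed del: set_upt set_rev)
    then have pow2': "alpha2 n [^]\<^bsub>?G\<^esub> (n - 2) = alpha0 n [^]\<^bsub>?G\<^esub> n"
      using pow2 alpha0_twist(3)[of n] assms by simp
    have conj_pow: "x [^]\<^bsub>?G\<^esub> r = alpha0 n \<otimes>\<^bsub>?G\<^esub> alpha2 n [^]\<^bsub>?G\<^esub> r \<otimes>\<^bsub>?G\<^esub> inv\<^bsub>?G\<^esub> alpha0 n"
      for r :: nat
    proof (induction r)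
      case (Suc r)
      then show ?case using a0 a2 unfolding x_def
        by (simp add: m_assoc inv_solve_left) (simp flip: m_assoc)
    qed (use a0 in simp)
    \<comment> \<open>By \<open>pow2'\<close> the power of \<open>alpha2 n\<close> is a power of
      \<open>alpha0 n\<close>, so conjugation by \<open>alpha0 n\<close> leaves it
      unchanged.\<close>
    have "alpha0 n \<otimes>\<^bsub>?G\<^esub> alpha0 n [^]\<^bsub>?G\<^esub> n \<otimes>\<^bsub>?G\<^esub> inv\<^bsub>?G\<^esub> alpha0 n = alpha0 n [^]\<^bsub>?G\<^esub> n"
      unfolding nat_pow_Suc2[OF a0, of n, symmetric] using a0 by (simp add: m_assoc)
    then show ?thesis
      using conj_pow[of "n - 2"] pow2' alpha0_twist(3)[of n] assms by simp
  qed
  show "x [^]\<^bsub>?G\<^esub> r \<noteq> \<one>\<^bsub>?G\<^esub>" if "0 < r" "r < n - 2"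
    unfolding x
  \<comment> \<open>The extra letter n - 1 exchanges only the top two positions, so 3, ..., n - 1
    are lowered by one. From n - 1 this allows n - 3 steps down to 2, which covers all r < n -
    2.\<close>
  proof (rule sphere_braid_pow_neq_one[OF w, of 2 "n - 1"])
    show "strand (pos_word ?w) a = a - 1" if "2 < a" "a \<le> n - 1" for a
      using that by (auto simp: strand_append strand_sweep)
  qed (use that in auto)
qed


declare One_nat_def [simp]

theorem theorem6:
  fixes n N l k j q :: nat
    and x :: "nat group_word set"
  assumes "n \<ge> 4" and "even n"
    and "N = n \<and> x = alpha0 n \<or>
         N = n - 2 \<and> x = alpha0 n \<otimes>\<^bsub>sphere_braid_group n\<^esub> alpha2 n
                          \<otimes>\<^bsub>sphere_braid_group n\<^esub> inv\<^bsub>sphere_braid_group n\<^esub> alpha0 n"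
    and "N = 2 ^ l * k" and "odd k"
    and "j \<le> l" and "q dvd k"
  shows "((\<forall>i\<in>{0..2 ^ j - 1}.
             subgroup (twist_subgroup n x j q i) (sphere_braid_group n) \<and>
             (sphere_braid_group n)\<lparr>carrier := twist_subgroup n x j q i\<rparr>
               \<cong> Dic (2 ^ (l + 2 - j) * k div q)) \<and>
          card (twist_subgroup n x j q ` {0..2 ^ j - 1}) = 2 ^ j) \<and>
         (\<forall>i\<in>{0..2 ^ j - 1}. \<forall>i'\<in>{0..2 ^ j - 1}.
            conjugate_subgroups (sphere_braid_group n)
              (twist_subgroup n x j q i) (twist_subgroup n x j q i')
            \<longleftrightarrow> even (int i - int i'))"
proof -
  let ?G = "sphere_braid_group n" and ?T = "half_twist n"
  interpret group ?G unfolding sphere_braid_group_def by (rule group_presented_group)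
  have T: "?T \<in> carrier ?G" by (simp only: half_twist_eq sphere_braid_closed set_garside)
  obtain P where P: "\<And>g h. g \<in> carrier ?G \<Longrightarrow> h \<in> carrier ?G \<Longrightarrow> P (g \<otimes>\<^bsub>?G\<^esub> h) \<longleftrightarrow> P g \<noteq> P h"
    and P_word: "\<And>u. set u \<subseteq> {1..<n} \<Longrightarrow> P (sphere_braid n u) \<longleftrightarrow> odd (length u)"
    by (rule sphere_braid_parity) blast
  have "x \<in> carrier ?G \<and> ?T \<otimes>\<^bsub>?G\<^esub> x = inv\<^bsub>?G\<^esub> x \<otimes>\<^bsub>?G\<^esub> ?T \<and> x [^]\<^bsub>?G\<^esub> N = ?T \<otimes>\<^bsub>?G\<^esub> ?T
      \<and> (\<forall>r. 0 < r \<longrightarrow> r < N \<longrightarrow> x [^]\<^bsub>?G\<^esub> r \<noteq> \<one>\<^bsub>?G\<^esub>) \<and> P x"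
    using assms(3)
  proof
    assume "N = n \<and> x = alpha0 n"
    \<comment> \<open>In both cases x is represented by n - 1 letters, an odd number because n is
      even.\<close>
    moreover have "P (alpha0 n)"
      unfolding alpha0_def using P_word[of "[1..<n]"] assms(1,2) by simp
    ultimately show ?thesis using alpha0_twist[where n = n] assms(1) by simp
  next
    assume x: "N = n - 2 \<and> x = alpha0 n \<otimes>\<^bsub>?G\<^esub> alpha2 n \<otimes>\<^bsub>?G\<^esub> inv\<^bsub>?G\<^esub> alpha0 n"
    have "set ([2..<n] @ [n - 1]) \<subseteq> {1..<n}" using assms(1) by auto
    then have "P (sphere_braid n ([2..<n] @ [n - 1]))"
      using P_word[of "[2..<n] @ [n - 1]"] assms(1,2) by simp
    then have "P x" using x alpha2_conjugate_eq[of n] assms(1) by simp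
    moreover have "N = n - 2" using x by simp
    ultimately show ?thesis using alpha2_conjugate_twist[OF assms(1) conjunct2[OF x]] by simp
  qed
  then have x: "x \<in> carrier ?G" and tx: "?T \<otimes>\<^bsub>?G\<^esub> x = inv\<^bsub>?G\<^esub> x \<otimes>\<^bsub>?G\<^esub> ?T"
    and xN: "x [^]\<^bsub>?G\<^esub> N = ?T \<otimes>\<^bsub>?G\<^esub> ?T"
    and small: "\<And>r. 0 < r \<Longrightarrow> r < N \<Longrightarrow> x [^]\<^bsub>?G\<^esub> r \<noteq> \<one>\<^bsub>?G\<^esub>"
    and Px: "P x"
    by auto
  have N: "N \<ge> 2" using assms(1,3) by auto
  have ord_dvd: "ord x dvd 2 * N"
    using dicyclic_order[OF x T tx xN] pow_eq_id[OF x] by simp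
  \<comment> \<open>A proper divisor of 2N is at most N. Permutations exclude orders below N, and
    the nontrivial full twist excludes N.\<close>
  have ord_x: "ord x = 2 * N"
  proof (rule ccontr)
    assume "ord x \<noteq> 2 * N"
    moreover obtain s where s: "2 * N = ord x * s" using ord_dvd by blast
    ultimately have "s \<noteq> 1" by auto
    have "ord x * s \<noteq> 0" using s N by linarith
    then have "ord x \<noteq> 0" "s \<noteq> 0" by simp_all
    with \<open>s \<noteq> 1\<close> have "2 \<le> s" by linarith
    then have "ord x * 2 \<le> 2 * N" unfolding s by (rule mult_le_mono2)
    moreover have "ord x \<noteq> N"
      using xN half_twist_square_neq_one[of n] assms(1) pow_ord_eq_1[OF x] by auto
    ultimately show False
      using small[of "ord x"] \<open>ord x \<noteq> 0\<close> pow_ord_eq_1[OF x] by linarith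
  qed
  note family = x T tx xN ord_x N
  obtain p where p: "k = q * p" using assms(7) by blast
  have q: "odd q" using p assms(5) by simp
  then have "q > 0" by (rule odd_pos)
  define d where "d = 2 ^ j * q"
  have "N = d * (2 ^ (l - j) * p)"
    unfolding assms(4) p d_def using assms(6) by (simp add: power_add[symmetric])
  then have d: "d dvd N" and "4 * (N div d) = 4 * (2 ^ (l - j) * p)"
    using \<open>q > 0\<close> by (auto simp: d_def)
  moreover have "2 ^ (l + 2 - j) * k div q = 4 * (2 ^ (l - j) * p)"
    using \<open>q > 0\<close> assms(6) by (simp add: p Suc_diff_le)
  ultimately have index: "4 * (N div d) = 2 ^ (l + 2 - j) * k div q" by simp
  have H: "twist_subgroup n x j q i = generate ?G {x [^]\<^bsub>?G\<^esub> d, x [^]\<^bsub>?G\<^esub> (i * q) \<otimes>\<^bsub>?G\<^esub> ?T}" for i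
    by (simp add: twist_subgroup_def d_def)
  have "inj_on (twist_subgroup n x j q) {0..2 ^ j - 1}"
  proof (rule inj_onI)
    fix i i' assume i: "i \<in> {0..2 ^ j - 1}" "i' \<in> {0..2 ^ j - 1}"
      and "twist_subgroup n x j q i = twist_subgroup n x j q i'"
    then have "int d dvd int (i * q) - int (i' * q)"
      unfolding H using generate_twisted_eq_iff[OF family d] by blast
    then have "int q * 2 ^ j dvd int q * (int i - int i')"
      by (simp add: d_def algebra_simps)
    then have "2 ^ j dvd int i - int i'" using \<open>q > 0\<close> by simp
    moreover have "\<bar>int i - int i'\<bar> < 2 ^ j"
    proof -
      have "i < 2 ^ j" "i' < 2 ^ j" using i by (auto simp: less_eq_Suc_le Suc_leI le_diff_conv2)
      then have "int i < 2 ^ j" "int i' < 2 ^ j" by (metis of_nat_less_numeral_power_cancel_iff)+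
      then show ?thesis by linarith
    qed
    ultimately show "i = i'" using dvd_imp_le_int[of "int i - int i'" "2 ^ j"] by fastforce
  qed
  then have "card (twist_subgroup n x j q ` {0..2 ^ j - 1}) = 2 ^ j"
    by (simp add: card_image)
  moreover have "conjugate_subgroups ?G (twist_subgroup n x j q i) (twist_subgroup n x j q i')
      \<longleftrightarrow> even (int i - int i')" if i: "i \<in> {0..2 ^ j - 1}" "i' \<in> {0..2 ^ j - 1}" for i i'
  proof
    assume conj: "conjugate_subgroups ?G (twist_subgroup n x j q i) (twist_subgroup n x j q i')"
    show "even (int i - int i')"
    \<comment> \<open>For j = 0 the exponent d = q is odd and the parity argument breaks down, but
      then 0 is the only index.\<close>
    proof (cases "j = 0")
      case True
      then show ?thesis using i by simp
    next
      case False
      then have "even d" by (simp add: d_def)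
      then have "even (int (i * q) - int (i' * q))"
        using conjugate_generate_twisted_parity[OF family d _ P Px] conj unfolding H by blast
      then show ?thesis using q by simp
    qed
  next
    assume "even (int i - int i')"
    then obtain s where "int i - int i' = 2 * s" by blast
    then have "int i' = int i - 2 * s" by simp
    \<comment> \<open>The conjugating element is x to the power -s q.\<close>
    then have "int (i' * q) = int (i * q) + 2 * (- s * int q)"
      by (simp only: of_nat_mult) (simp add: left_diff_distrib)
    then show "conjugate_subgroups ?G (twist_subgroup n x j q i) (twist_subgroup n x j q i')"
      unfolding H by (rule conjugate_generate_twisted[OF family d])
  qed
  moreover have "subgroup (twist_subgroup n x j q i) ?G" for i
    unfolding H using x T by (intro generate_is_subgroup) auto
  moreover have "?G\<lparr>carrier := twist_subgroup n x j q i\<rparr> \<cong> Dic (2 ^ (l + 2 - j) * k div q)" for i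
    unfolding H index[symmetric] by (rule generate_twisted_iso_Dic[OF family d])
  ultimately show ?thesis by blast
qed

end
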